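(* Let $F$ be a real quadratic field and let $K$ be a quartic CM field, Galois over $\mathbb{Q}$ and containing $F$, with discriminant $\Delta_K$. For a reduced matrix $Z=\begin{pmatrix} z_1 & z_{12} \\ z_{12} & z_2 \end{pmatrix}\in\mathcal{F}_2$ corresponding to a choice of CM triple $(I,\xi,\Phi)$ on $K$, we have $$|z_{12}|\geq \frac{2}{3}\,|\Delta_K|^{-1/2}.$$
   Context: $\mathbb{H}_2$ is the Siegel upper half space of symmetric $2\times2$ complex matrices with positive definite imaginary part. Its fundamental domain $\mathcal{F}_2$ is the set of $Z=X+iY\in\mathbb{H}_2$, with $X=\begin{pmatrix} x_1 & x_{12} \\ x_{12} & x_2 \end{pmatrix}$, $Y=\begin{pmatrix} y_1 & y_{12} \\ y_{12} & y_2 \end{pmatrix}$ real, such that: (S1) $-\frac12\le x_i<\frac12$ for $i=1,2,12$; (S2) $0\le 2y_{12}\le y_1\le y_2$; (S3) $|\det(CZ+D)|\ge1$ for all $\begin{pmatrix} A & B \\ C & D \end{pmatrix}\in\operatorname{Sp}_4(\mathbb{Z})$. CM triple $(I,\xi,\Phi)$ on $K$: a fractional ideal $I$ of $K$, a CM type $\Phi=(\phi_1,\phi_2)$ of $K$ (embeddings $K\to\mathbb{C}$, one from each pair of complex conjugate embeddings), and a totally imaginary $\xi\in K$ such that $\xi\bar I I=\mathcal{D}_{K/\mathbb{Q}}^{-1}$ (inverse different) and $\phi_1(\xi),\phi_2(\xi)$ have positive imaginary part. Write $\Phi(x)=(\phi_1(x),\phi_2(x))\in\mathbb{C}^2$.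 The associated Riemann form on $\mathbb{C}^2$ is $E_{\Phi,\xi}(z,w)=\sum_{j=1}^2\phi_j(\xi)(z_j\overline{w_j}-\overline{z_j}w_j)$, so that $E_{\Phi,\xi}(\Phi(x),\Phi(y))=-\operatorname{Tr}_{K/\mathbb{Q}}(\xi\bar x y)$ for $x,y\in K$. A symplectic $\mathbb{Z}$-basis of $I$ is a $\mathbb{Z}$-basis $(e_1,e_2,e_3,e_4)$ with $E_{\Phi,\xi}(\Phi(e_i),\Phi(e_j))=1$ if $j=i+2$, $-1$ if $j=i-2$, and $0$ otherwise. It defines $Z\in\mathbb{H}_2$ by $\Phi(e_3)=z_1\Phi(e_1)+z_{12}\Phi(e_2)$ and $\Phi(e_4)=z_{12}\Phi(e_1)+z_2\Phi(e_2)$. A reduced matrix corresponding to $(I,\xi,\Phi)$ is such a $Z$, for some symplectic basis, that lies in $\mathcal{F}_2$.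
   Formalization: Added hypothesis: K is cyclic over Q or z_12 ≠ 0. Without it the claim fails: for K = Q(i,√5), I = O_K and Φ with φ_1(i) = φ_2(i) = i, the matrix Z = diag(i,i) is reduced and has z_12 = 0. *)

theory Defs
  imports "HOL-Analysis.Analysis" "HOL-Computational_Algebra.Polynomial"
begin

text \<open>
  The number field \<open>K\<close> is a type \<open>'k\<close> of class \<open>field_char_0\<close> and its subfields are
  sets. An embedding of a subfield \<open>L\<close> is a function on all of \<open>'k\<close> of which only the values
  on \<open>L\<close> matter.
\<close>

subsection \<open>Number fields, CM fields\<close>

definition is_subfield :: "'k::field_char_0 set \<Rightarrow> bool" where
  "is_subfield L \<longleftrightarrow> 0 \<in> L \<and> 1 \<in> L \<and>
     (\<forall>x\<in>L. \<forall>y\<in>L. x + y \<in> L \<and> x - y \<in> L \<and> x * y \<in> L) \<and> (\<forall>x\<in>L. inverse x \<in> L)"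

text \<open>The library's \<open>dim\<close> is 0 for infinite-dimensional spaces, so a positive value is the
  degree of a number field.\<close>

definition degree_over_rat :: "'k::field_char_0 set \<Rightarrow> nat" where
  "degree_over_rat L = vector_space.dim (\<lambda>(q::rat) (x::'k). of_rat q * x) L"

definition embedding_on :: "'k::field_char_0 set \<Rightarrow> ('k \<Rightarrow> complex) \<Rightarrow> bool" where
  "embedding_on L \<phi> \<longleftrightarrow> \<phi> 1 = 1 \<and>
     (\<forall>x\<in>L. \<forall>y\<in>L. \<phi> (x + y) = \<phi> x + \<phi> y \<and> \<phi> (x * y) = \<phi> x * \<phi> y)"

definition embeddings :: "('k::field_char_0 \<Rightarrow> complex) set" where
  "embeddings = {\<phi>. embedding_on UNIV \<phi>}"

definition totally_real :: "'k::field_char_0 set \<Rightarrow> bool" where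
  "totally_real L \<longleftrightarrow> (\<forall>\<phi>. embedding_on L \<phi> \<longrightarrow> \<phi> ` L \<subseteq> \<real>)"

definition real_quadratic_field :: "'k::field_char_0 set \<Rightarrow> bool" where
  "real_quadratic_field F \<longleftrightarrow> is_subfield F \<and> degree_over_rat F = 2 \<and> totally_real F"

text \<open>A totally imaginary quadratic extension of a totally real number field \<open>K0\<close>;
  the pair \<open>u, v\<close> is a basis of \<open>K\<close> over \<open>K0\<close>.\<close>

definition CM_field :: "'k::field_char_0 itself \<Rightarrow> bool" where
  "CM_field _ \<longleftrightarrow>
     degree_over_rat (UNIV :: 'k set) > 0 \<and>
     (\<forall>\<phi>\<in>(embeddings :: ('k \<Rightarrow> complex) set). \<not> range \<phi> \<subseteq> \<real>) \<and>
     (\<exists>K0 :: 'k set. is_subfield K0 \<and> totally_real K0 \<and>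
        (\<exists>u v. bij_betw (\<lambda>(a, b). a * u + b * v) (K0 \<times> K0) UNIV))"

definition quartic_CM_field :: "'k::field_char_0 itself \<Rightarrow> bool" where
  "quartic_CM_field K \<longleftrightarrow> CM_field K \<and> degree_over_rat (UNIV :: 'k set) = 4"

text \<open>Ring automorphisms of a field of characteristic 0 automatically fix the rationals.\<close>

definition field_auts :: "('k::field_char_0 \<Rightarrow> 'k) set" where
  "field_auts = {\<sigma>. bij \<sigma> \<and> (\<forall>x y. \<sigma> (x + y) = \<sigma> x + \<sigma> y \<and> \<sigma> (x * y) = \<sigma> x * \<sigma> y)}"

definition galois_over_rat :: "'k::field_char_0 itself \<Rightarrow> bool" where
  "galois_over_rat _ \<longleftrightarrow> {x :: 'k. \<forall>\<sigma>\<in>field_auts. \<sigma> x = x} = \<rat>"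

text \<open>
  A period matrix of a non-cyclic \<open>K\<close> can have \<open>z\<^sub>1\<^sub>2 = 0\<close>: for the maximal order of the compositum of the
  Gaussian field and the field of \<open>sqrt 5\<close>, with both embeddings of the CM type extending
  the same embedding of the Gaussian field, \<open>Z = diag(i, i)\<close> occurs. A bound
  \<open>|z\<^sub>1\<^sub>2| > 0\<close> therefore needs cyclicity or \<open>z\<^sub>1\<^sub>2 \<noteq> 0\<close> as a hypothesis.
\<close>

definition cyclic_auts :: "'k::field_char_0 itself \<Rightarrow> bool" where
  "cyclic_auts _ \<longleftrightarrow>
     (\<exists>\<sigma>\<in>(field_auts :: ('k \<Rightarrow> 'k) set). \<forall>\<tau>\<in>field_auts. \<exists>n::nat. \<tau> = \<sigma> ^^ n)"

text \<open>Complex conjugation of a CM field: it commutes with every embedding.\<close>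

definition cm_conj :: "'k::field_char_0 \<Rightarrow> 'k" where
  "cm_conj x = (THE y. \<forall>\<phi>\<in>embeddings. \<phi> y = cnj (\<phi> x))"

definition totally_imaginary :: "'k::field_char_0 \<Rightarrow> bool" where
  "totally_imaginary x \<longleftrightarrow> (\<forall>\<phi>\<in>embeddings. Re (\<phi> x) = 0)"

subsection \<open>Ideals, different, discriminant\<close>

definition ring_of_integers :: "'k::field_char_0 set" where
  "ring_of_integers = {x. algebraic_int x}"

definition field_trace :: "'k::field_char_0 \<Rightarrow> complex" where
  "field_trace x = (\<Sum>\<phi>\<in>embeddings. \<phi> x)"

definition inverse_different :: "'k::field_char_0 set" where
  "inverse_different = {x. \<forall>y\<in>ring_of_integers. field_trace (x * y) \<in> \<int>}"

definition fractional_ideal :: "'k::field_char_0 set \<Rightarrow> bool" where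
  "fractional_ideal I \<longleftrightarrow> 0 \<in> I \<and> I \<noteq> {0} \<and> (\<forall>x\<in>I. \<forall>y\<in>I. x + y \<in> I) \<and>
     (\<forall>a\<in>ring_of_integers. \<forall>x\<in>I. a * x \<in> I) \<and>
     (\<exists>d\<in>ring_of_integers. d \<noteq> 0 \<and> (\<forall>x\<in>I. d * x \<in> ring_of_integers))"

definition ideal_mult :: "'k::field_char_0 set \<Rightarrow> 'k set \<Rightarrow> 'k set" where
  "ideal_mult A B =
     {\<Sum>i<n. a i * b i | (n::nat) a b. \<forall>i<n. a i \<in> A \<and> b i \<in> B}"

text \<open>Every element of \<open>I\<close> is a unique integral combination of the family \<open>(b i)\<close>, \<open>i \<in> S\<close>.\<close>

definition Z_basis :: "'i set \<Rightarrow> ('i \<Rightarrow> 'k::field_char_0) \<Rightarrow> 'k set \<Rightarrow> bool" where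
  "Z_basis S b I \<longleftrightarrow>
     bij_betw (\<lambda>c :: 'i \<Rightarrow> int. \<Sum>i\<in>S. of_int (c i) * b i) (S \<rightarrow>\<^sub>E UNIV) I"

text \<open>The trace-form determinant of any integral basis; the index type \<open>4\<close> makes this the
  discriminant for quartic fields only.\<close>

definition quartic_discriminant :: "'k::field_char_0 itself \<Rightarrow> int" where
  "quartic_discriminant _ = (THE D. \<exists>b :: 4 \<Rightarrow> 'k. Z_basis UNIV b ring_of_integers \<and>
     of_int D = det (\<chi> i j. field_trace (b i * b j)))"

subsection \<open>CM triples and the Riemann form\<close>

text \<open>Exactly one embedding from each pair of complex conjugate embeddings.\<close>

definition CM_type :: "(2 \<Rightarrow> 'k::field_char_0 \<Rightarrow> complex) \<Rightarrow> bool" where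
  "CM_type \<Phi> \<longleftrightarrow> (\<forall>j. \<Phi> j \<in> embeddings) \<and>
     (\<forall>\<psi>\<in>embeddings. \<exists>!j. \<Phi> j = \<psi> \<or> \<Phi> j = (\<lambda>x. cnj (\<psi> x)))"

definition CM_triple ::
  "'k::field_char_0 set \<Rightarrow> 'k \<Rightarrow> (2 \<Rightarrow> 'k \<Rightarrow> complex) \<Rightarrow> bool" where
  "CM_triple I \<xi> \<Phi> \<longleftrightarrow> fractional_ideal I \<and> CM_type \<Phi> \<and> totally_imaginary \<xi> \<and>
     (\<lambda>x. \<xi> * x) ` ideal_mult (cm_conj ` I) I = inverse_different \<and>
     (\<forall>j. Im (\<Phi> j \<xi>) > 0)"

definition CM_vec :: "(2 \<Rightarrow> 'k::field_char_0 \<Rightarrow> complex) \<Rightarrow> 'k \<Rightarrow> complex^2" where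
  "CM_vec \<Phi> x = (\<chi> j. \<Phi> j x)"

definition riemann_form ::
  "(2 \<Rightarrow> 'k::field_char_0 \<Rightarrow> complex) \<Rightarrow> 'k \<Rightarrow> complex^2 \<Rightarrow> complex^2 \<Rightarrow> complex" where
  "riemann_form \<Phi> \<xi> z w =
     (\<Sum>j\<in>UNIV. \<Phi> j \<xi> * (z $ j * cnj (w $ j) - cnj (z $ j) * w $ j))"

definition symplectic_basis ::
  "'k::field_char_0 set \<Rightarrow> 'k \<Rightarrow> (2 \<Rightarrow> 'k \<Rightarrow> complex) \<Rightarrow> (nat \<Rightarrow> 'k) \<Rightarrow> bool" where
  "symplectic_basis I \<xi> \<Phi> e \<longleftrightarrow> Z_basis {1..4} e I \<and>
     (\<forall>i\<in>{1..4}. \<forall>j\<in>{1..4}. riemann_form \<Phi> \<xi> (CM_vec \<Phi> (e i)) (CM_vec \<Phi> (e j)) =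
        (if j = i + 2 then 1 else if i = j + 2 then -1 else 0))"

subsection \<open>The Siegel upper half space and its fundamental domain\<close>

definition siegel_upper_half_space :: "(complex^2^2) set" where
  "siegel_upper_half_space = {Z. transpose Z = Z \<and>
     (\<forall>v :: real^2. v \<noteq> 0 \<longrightarrow> v \<bullet> (map_matrix Im Z *v v) > 0)}"

definition block_matrix ::
  "'a^'n^'n \<Rightarrow> 'a^'n^'n \<Rightarrow> 'a^'n^'n \<Rightarrow> 'a^'n^'n \<Rightarrow> 'a^('n + 'n)^('n + 'n)" where
  "block_matrix A B C D = (\<chi> i j.
     case i of Inl k \<Rightarrow> (case j of Inl l \<Rightarrow> A $ k $ l | Inr l \<Rightarrow> B $ k $ l)
             | Inr k \<Rightarrow> (case j of Inl l \<Rightarrow> C $ k $ l | Inr l \<Rightarrow> D $ k $ l))"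

definition Sp4_int :: "(int^(2 + 2)^(2 + 2)) set" where
  "Sp4_int = (let J = block_matrix 0 (mat 1) (- mat 1) 0
              in {M. transpose M ** J ** M = J})"

definition siegel_fundamental_domain :: "(complex^2^2) set" where
  "siegel_fundamental_domain = {Z \<in> siegel_upper_half_space.
     (\<forall>(i, j)\<in>{(1, 1), (2, 2), (1, 2)}. -1/2 \<le> Re (Z $ i $ j) \<and> Re (Z $ i $ j) < 1/2) \<and>
     0 \<le> 2 * Im (Z $ 1 $ 2) \<and> 2 * Im (Z $ 1 $ 2) \<le> Im (Z $ 1 $ 1) \<and>
     Im (Z $ 1 $ 1) \<le> Im (Z $ 2 $ 2) \<and>
     (\<forall>A B C D. block_matrix A B C D \<in> Sp4_int \<longrightarrow>
        cmod (det (map_matrix of_int C ** Z + map_matrix of_int D)) \<ge> 1)}"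

definition reduced_matrix_of ::
  "'k::field_char_0 set \<Rightarrow> 'k \<Rightarrow> (2 \<Rightarrow> 'k \<Rightarrow> complex) \<Rightarrow> complex^2^2 \<Rightarrow> bool" where
  "reduced_matrix_of I \<xi> \<Phi> Z \<longleftrightarrow> Z \<in> siegel_fundamental_domain \<and>
     (\<exists>e. symplectic_basis I \<xi> \<Phi> e \<and>
        CM_vec \<Phi> (e 3) = Z $ 1 $ 1 *s CM_vec \<Phi> (e 1) + Z $ 1 $ 2 *s CM_vec \<Phi> (e 2) \<and>
        CM_vec \<Phi> (e 4) = Z $ 1 $ 2 *s CM_vec \<Phi> (e 1) + Z $ 2 $ 2 *s CM_vec \<Phi> (e 2))"

end

theory Submission
  imports Defs "HOL-Computational_Algebra.Fundamental_Theorem_Algebra"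
begin

text \<open>
  Let \<open>e\<^sub>1, \<dots>, e\<^sub>4\<close> be the symplectic basis, \<open>\<psi>\<^sub>1, \<dots>, \<psi>\<^sub>4\<close> the embeddings \<open>\<phi>\<^sub>1, \<phi>\<^sub>2\<close> and their conjugates, and
  \<open>\<tau> = |\<phi>\<^sub>1(\<xi>) \<phi>\<^sub>2(\<xi>)|\<close>. By Cramer's rule \<open>z\<^sub>1\<^sub>2\<close> is the quotient of the minors of \<open>\<Phi>(e\<^sub>1), \<Phi>(e\<^sub>3)\<close> and of
  \<open>\<Phi>(e\<^sub>1), \<Phi>(e\<^sub>2)\<close>. The period relations give \<open>1 / (4 \<tau> det Y)\<close> for the squared modulus of the latter,
  so with \<open>S\<close> the squared modulus of the former, \<open>|z\<^sub>1\<^sub>2|\<^sup>2 = 4 \<tau> S det Y\<close>, where \<open>det Y \<ge> 9/16\<close> in the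
  fundamental domain. It remains to bound \<open>S\<close> from below.

  Let \<open>T\<close> be the analogue of \<open>S\<close> with \<open>\<phi>\<^sub>2\<close> replaced by its conjugate. The relation between \<open>e\<^sub>1\<close> and \<open>e\<^sub>3\<close>
  gives \<open>T \<le> S + 1 / (4 \<tau>)\<close>, and \<open>S + T\<close> and \<open>S T\<close> are rational. The symplectic
  relations make the discriminant of the lattice equal to \<open>1 / \<tau>\<^sup>2\<close>, so \<open>\<rho> = det(\<psi>\<^sub>l(e\<^sub>i)) / det(\<psi>\<^sub>l(\<omega>\<^sub>i))\<close>,
  with \<open>\<omega>\<close> an integral basis, has \<open>\<rho>\<^sup>2 = 1 / (\<tau>\<^sup>2 |\<Delta>|)\<close>. The norm form of the lattice is \<open>\<rho>\<close> times an
  integral polynomial, so by the Gauss lemma for algebraic integers every product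
  \<open>\<psi>\<^sub>1(e\<^sub>i) \<psi>\<^sub>2(e\<^sub>j) \<psi>\<^sub>3(e\<^sub>k) \<psi>\<^sub>4(e\<^sub>l)\<close> is \<open>\<rho>\<close> times an algebraic integer, and so are \<open>S\<close> and \<open>T\<close>. Hence
  \<open>S T \<ge> \<rho>\<^sup>2\<close> if \<open>T \<noteq> 0\<close>, and \<open>S \<ge> |\<rho>|\<close> if \<open>T = 0\<close>.
\<close>

subsection \<open>Algebraic integers\<close>

definition coeffs_in :: "'a::comm_ring_1 set \<Rightarrow> 'a poly \<Rightarrow> bool" where
  "coeffs_in R p \<longleftrightarrow> (\<forall>n. coeff p n \<in> R)"

lemma coeffs_in_Ints_mult:
  "coeffs_in \<int> p \<Longrightarrow> coeffs_in \<int> q \<Longrightarrow> coeffs_in \<int> (p * q)"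
  by (auto simp: coeffs_in_def coeff_mult intro!: Ints_sum Ints_mult)

lemma coeffs_in_Ints_diff:
  "coeffs_in \<int> p \<Longrightarrow> coeffs_in \<int> q \<Longrightarrow> coeffs_in \<int> (p - q)"
  by (auto simp: coeffs_in_def)

text \<open>Determinant-free Cayley--Hamilton: the shape (monic diagonal of degree \<open>d\<close>, smaller degrees
  elsewhere) is preserved by eliminating an unknown without division, with \<open>d\<close> doubled.\<close>

lemma algebraic_int_if_linear_system:
  fixes y :: "'a::field_char_0" and P :: "'i \<Rightarrow> 'i \<Rightarrow> 'a poly"
  assumes "finite S" "d > 0"
    and "\<And>i. i \<in> S \<Longrightarrow> degree (P i i) = d \<and> lead_coeff (P i i) = 1"
    and "\<And>i j. i \<in> S \<Longrightarrow> j \<in> S \<Longrightarrow> i \<noteq> j \<Longrightarrow> degree (P i j) < d"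
    and "\<And>i j. i \<in> S \<Longrightarrow> j \<in> S \<Longrightarrow> coeffs_in \<int> (P i j)"
    and "\<And>i. i \<in> S \<Longrightarrow> (\<Sum>j\<in>S. poly (P i j) y * v j) = 0"
    and "k \<in> S" "v k \<noteq> 0"
  shows "algebraic_int y"
  using assms
proof (induction "card S" arbitrary: S P d)
  case 0
  then show ?case by auto
next
  case (Suc n)
  show ?case
  proof (cases "S = {k}")
    case True
    with Suc.prems have "poly (P k k) y * v k = 0" by force
    with Suc.prems show ?thesis
      by (intro algebraic_int.intros[of "P k k"]) (auto simp: coeffs_in_def)
  next
    case False
    \<comment> \<open>The eliminated unknown differs from \<open>k\<close>, so that the nonzero
      entry \<open>v k\<close> survives to the final system of one equation.\<close>
    then obtain l where l: "l \<in> S" "l \<noteq> k" using Suc.prems by auto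
    define S' where "S' = S - {l}"
    \<comment> \<open>Row \<open>i\<close> times the pivot \<open>P l l\<close> minus
      \<open>P i l\<close> times row \<open>l\<close>. On the diagonal the monic product
      \<open>P l l * P i i\<close> has degree \<open>d + d\<close> and dominates the
      correction.\<close>
    define Q where "Q = (\<lambda>i j. P l l * P i j - P i l * P l j)"
    have S: "S = insert l S'" "l \<notin> S'" "finite S'" "k \<in> S'"
      using l Suc.prems by (auto simp: S'_def)
    have deg_le: "degree (P i l * P l j) < d + d" if "i \<in> S'" "j \<in> S'" for i j
    proof -
      have "degree (P i l) < d" "degree (P l j) < d"
        using that S Suc.prems(4)[of i l] Suc.prems(4)[of l j] by auto
      then show ?thesis using degree_mult_le[of "P i l" "P l j"] by linarith
    qed
    show ?thesis
    proof (rule Suc.hyps(1)[of S' "d + d" Q])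
      show "n = card S'" using Suc.hyps(2) S Suc.prems(1) by simp
      show "degree (Q i i) = d + d \<and> lead_coeff (Q i i) = 1" if i: "i \<in> S'" for i
      proof -
        have 1: "degree (P l l) = d" "lead_coeff (P l l) = 1"
          "degree (P i i) = d" "lead_coeff (P i i) = 1"
          using Suc.prems(3)[of l] Suc.prems(3)[of i] i S by auto
        have ne: "P l l \<noteq> 0" "P i i \<noteq> 0" using 1 by auto
        have 2: "degree (P l l * P i i) = d + d" "lead_coeff (P l l * P i i) = 1"
          using 1 ne by (auto simp: degree_mult_eq) (metis coeff_mult_degree_sum mult_1)
        have 3: "degree (- (P i l * P i l)) = degree (P i l * P i l)" by simp
        have 4: "degree (Q i i) = d + d"
          using degree_add_eq_left[of "- (P i l * P l i)" "P l l * P i i"] deg_le[OF i i] 2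
          by (simp add: Q_def)
        moreover have "coeff (Q i i) (d + d) = 1"
          using 2 deg_le[OF i i] by (simp add: Q_def coeff_eq_0)
        ultimately show ?thesis by simp
      qed
      show "degree (Q i j) < d + d" if ij: "i \<in> S'" "j \<in> S'" "i \<noteq> j" for i j
      proof -
        have "degree (P l l * P i j) < d + d"
          using degree_mult_le[of "P l l" "P i j"] Suc.prems(3)[of l] Suc.prems(4)[of i j] ij S
          by (metis add_less_le_mono add.commute insertCI le_less_trans add_le_less_mono order_refl)
        then show ?thesis using deg_le ij by (simp add: Q_def degree_diff_less)
      qed
      show "coeffs_in \<int> (Q i j)" if "i \<in> S'" "j \<in> S'" for i j
        unfolding Q_def using that S Suc.prems(5) by (intro coeffs_in_Ints_diff coeffs_in_Ints_mult) auto
      show "(\<Sum>j\<in>S'. poly (Q i j) y * v j) = 0" if "i \<in> S'" for i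
      proof -
        have "(\<Sum>j\<in>S. poly (P i j) y * v j) = 0" "(\<Sum>j\<in>S. poly (P l j) y * v j) = 0"
          using Suc.prems(6) that S by auto
        then have a: "poly (P i l) y * v l + (\<Sum>j\<in>S'. poly (P i j) y * v j) = 0"
          and b: "poly (P l l) y * v l + (\<Sum>j\<in>S'. poly (P l j) y * v j) = 0"
          using S by auto
        have "(\<Sum>j\<in>S'. poly (Q i j) y * v j) = poly (P l l) y * (\<Sum>j\<in>S'. poly (P i j) y * v j)
            - poly (P i l) y * (\<Sum>j\<in>S'. poly (P l j) y * v j)"
          by (simp add: Q_def sum_distrib_left sum_subtractf algebra_simps)
        also have "\<dots> = poly (P l l) y * (poly (P i l) y * v l + (\<Sum>j\<in>S'. poly (P i j) y * v j))
            - poly (P i l) y * (poly (P l l) y * v l + (\<Sum>j\<in>S'. poly (P l j) y * v j))"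
          by (simp add: algebra_simps)
        finally show ?thesis by (simp only: a b) simp
      qed
    qed (use Suc.prems S in auto)
  qed
qed

section \<open>Finitely generated Z-modules and the finiteness criterion for integrality\<close>

definition zspan :: "'a::comm_ring_1 set \<Rightarrow> 'a set" where
  "zspan G = range (\<lambda>c :: 'a \<Rightarrow> int. \<Sum>g\<in>G. of_int (c g) * g)"

lemma zspan_0 [simp]: "0 \<in> zspan G"
  by (auto simp: zspan_def intro!: image_eqI[where x = "\<lambda>_. 0"])

lemma zspan_base: "finite G \<Longrightarrow> g \<in> G \<Longrightarrow> g \<in> zspan G"
  by (auto simp: zspan_def if_distrib[of of_int] if_distrib[of "\<lambda>x. x * _"] cong: if_cong
      intro!: image_eqI[where x = "\<lambda>h. if h = g then 1 else 0"])

lemma zspan_add: "x \<in> zspan G \<Longrightarrow> y \<in> zspan G \<Longrightarrow> x + y \<in> zspan G"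
  by (auto simp: zspan_def sum.distrib[symmetric] algebra_simps
      intro!: image_eqI[where x = "\<lambda>g. _ g + _ g"])

lemma zspan_cmult: "x \<in> zspan G \<Longrightarrow> of_int m * x \<in> zspan G"
  by (auto simp: zspan_def sum_distrib_left mult.assoc intro!: image_eqI[where x = "\<lambda>g. m * _ g"])

lemma zspan_sum: "(\<And>i. i \<in> A \<Longrightarrow> f i \<in> zspan G) \<Longrightarrow> (\<Sum>i\<in>A. f i) \<in> zspan G"
  by (induction A rule: infinite_finite_induct) (auto intro: zspan_add)

lemma zspan_mult_closed:
  assumes "\<And>g. g \<in> G \<Longrightarrow> y * g \<in> zspan H" "u \<in> zspan G"
  shows "y * u \<in> zspan H"
proof -
  obtain c where u: "u = (\<Sum>g\<in>G. of_int (c g) * g)" using assms(2) by (auto simp: zspan_def)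
  have "y * u = (\<Sum>g\<in>G. of_int (c g) * (y * g))"
    by (simp add: u sum_distrib_left algebra_simps)
  then show ?thesis using assms(1) by (auto intro!: zspan_sum zspan_cmult)
qed

text \<open>Multiplication by \<open>y\<close> acts on the generators through an integer matrix
  \<open>c\<close>, so the generators form a nonzero solution of the linear system with matrix
  \<open>y - c\<close>, whose diagonal is monic of degree 1 in \<open>y\<close>.\<close>

lemma algebraic_int_if_stable:
  fixes y :: "'a::field_char_0"
  assumes "finite G" "k \<in> G" "k \<noteq> 0" and stab: "\<And>g. g \<in> G \<Longrightarrow> y * g \<in> zspan G"
  shows "algebraic_int y"
proof -
  have "\<forall>g\<in>G. \<exists>c :: 'a \<Rightarrow> int. y * g = (\<Sum>h\<in>G. of_int (c h) * h)"
    using stab by (auto simp: zspan_def)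
  then obtain c :: "'a \<Rightarrow> 'a \<Rightarrow> int" where c: "\<And>g. g \<in> G \<Longrightarrow> y * g = (\<Sum>h\<in>G. of_int (c g h) * h)"
    by metis
  define P :: "'a \<Rightarrow> 'a \<Rightarrow> 'a poly"
    where "P = (\<lambda>g h. if g = h then [:- of_int (c g g), 1:] else [:- of_int (c g h):])"
  show ?thesis
  proof (rule algebraic_int_if_linear_system[of G 1 P y "\<lambda>g. g"])
    show "(\<Sum>j\<in>G. poly (P i j) y * j) = 0" if "i \<in> G" for i
    proof -
      have "(\<Sum>j\<in>G. poly (P i j) y * j) =
          (\<Sum>j\<in>G. (if j = i then y * j else 0) - of_int (c i j) * j)"
        by (intro sum.cong) (auto simp: P_def algebra_simps)
      also have "\<dots> = y * i - (\<Sum>j\<in>G. of_int (c i j) * j)"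
        using assms(1) that by (simp add: sum_subtractf)
      finally show ?thesis using c[OF that] by simp
    qed
  qed (use assms in \<open>auto simp: P_def coeffs_in_def coeff_pCons split: nat.splits\<close>)
qed

text \<open>The span of \<open>G\<close> is then a module over the ring generated by
  \<open>A\<close>. With \<open>G\<close> finite and containing 1, this is the finiteness criterion
  for all elements of \<open>A\<close> at once.\<close>

definition stable_under :: "'a::comm_ring_1 set \<Rightarrow> 'a set \<Rightarrow> bool" where
  "stable_under A G \<longleftrightarrow> (\<forall>a\<in>A. \<forall>g\<in>G. a * g \<in> zspan G)"

text \<open>The products \<open>g * y ^ k\<close> with \<open>k < n\<close> generate the new module,
  and the relation rewrites \<open>y ^ n\<close>, the one power that leaves this range. The
  coefficients \<open>c k\<close> are asked to map \<open>G\<close> into its span, which covers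
  integers and algebraic integers alike.\<close>

lemma stable_under_extend:
  fixes y :: "'a::field_char_0"
  assumes G: "finite G" "1 \<in> G" and stab: "stable_under A G"
    and n: "n > 0" and y: "y ^ n = (\<Sum>k<n. c k * y ^ k)"
    and c: "\<And>k g. k < n \<Longrightarrow> g \<in> G \<Longrightarrow> c k * g \<in> zspan G"
  shows "\<exists>H. finite H \<and> 1 \<in> H \<and> stable_under (insert y A) H"
proof -
  define H where "H = (\<lambda>(g, k). g * y ^ k) ` (G \<times> {..<n})"
  have H: "finite H" using G by (simp add: H_def)
  have HE: "\<exists>g k. h = g * y ^ k \<and> g \<in> G \<and> k < n" if "h \<in> H" for h
    using that by (auto simp: H_def)
  have inH: "y ^ k * g \<in> zspan H" if "k < n" "g \<in> zspan G" for k g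
  proof (rule zspan_mult_closed[OF _ that(2)])
    fix h assume "h \<in> G"
    then have "y ^ k * h \<in> H" using that(1) by (auto simp: H_def mult.commute intro!: image_eqI[where x = "(h, k)"])
    then show "y ^ k * h \<in> zspan H" using H by (intro zspan_base)
  qed
  have "a * h \<in> zspan H" if "a \<in> A" "h \<in> H" for a h
  proof -
    obtain g k where h: "h = g * y ^ k" "g \<in> G" "k < n" using HE[OF \<open>h \<in> H\<close>] by blast
    have "y ^ k * (a * g) \<in> zspan H"
      using h that stab by (intro inH) (auto simp: stable_under_def)
    then show ?thesis by (simp add: h mult_ac)
  qed
  moreover have "y * h \<in> zspan H" if "h \<in> H" for h
  proof -
    obtain g k where h: "h = g * y ^ k" "g \<in> G" "k < n" using HE[OF \<open>h \<in> H\<close>] by blast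
    show ?thesis
    proof (cases "Suc k < n")
      case True
      then have "y ^ Suc k * g \<in> zspan H" using h G by (intro inH zspan_base) auto
      then show ?thesis by (simp add: h mult_ac)
    next
      case False
      then have "Suc k = n" using h by auto
      then have "y * h = g * y ^ n" by (auto simp: h)
      also have "\<dots> = (\<Sum>k<n. y ^ k * (c k * g))" by (simp add: y sum_distrib_left mult_ac)
      also have "\<dots> \<in> zspan H" using h by (intro zspan_sum inH c) auto
      finally show ?thesis .
    qed
  qed
  moreover have "1 \<in> H" using G n by (auto simp: H_def intro!: image_eqI[where x = "(1, 0)"])
  ultimately show ?thesis using H by (intro exI[of _ H]) (auto simp: stable_under_def)
qed

lemma stable_under_exists:
  fixes A :: "'a::field_char_0 set"
  assumes "finite A" "\<And>a. a \<in> A \<Longrightarrow> algebraic_int a"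
  shows "\<exists>G. finite G \<and> 1 \<in> G \<and> stable_under A G"
  using assms
proof (induction A)
  case empty
  then show ?case by (intro exI[of _ "{1}"]) (auto simp: stable_under_def)
next
  case (insert y A)
  then obtain G where G: "finite G" "1 \<in> G" "stable_under A G" by auto
  from insert.prems obtain p where p: "lead_coeff p = 1" "\<And>i. coeff p i \<in> \<int>" "poly p y = 0"
    by (metis algebraic_int.cases insertI1)
  define n where "n = degree p"
  have n: "n > 0" using p by (intro Nat.gr0I) (auto simp: n_def elim!: degree_eq_zeroE)
  have "0 = (\<Sum>k\<le>n. coeff p k * y ^ k)" using p by (simp add: poly_altdef n_def)
  also have "\<dots> = (\<Sum>k<n. coeff p k * y ^ k) + y ^ n"
    using p by (simp add: n_def lessThan_Suc_atMost[symmetric])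
  finally have y: "y ^ n = (\<Sum>k<n. - coeff p k * y ^ k)"
    by (simp add: sum_negf eq_neg_iff_add_eq_0 add.commute)
  show ?case
  proof (rule stable_under_extend[OF G n y])
    show "- coeff p k * g \<in> zspan G" if "g \<in> G" for k g
    proof -
      obtain m where "- coeff p k = of_int m" using p(2)[of k] by (metis Ints_cases of_int_minus)
      then show ?thesis using that G by (simp add: zspan_cmult zspan_base)
    qed
  qed
qed

section \<open>Ring operations and integral closure\<close>

lemma algebraic_int_add_mult:
  fixes x y :: "'a::field_char_0"
  assumes "algebraic_int x" "algebraic_int y"
  shows "algebraic_int (x + y)" "algebraic_int (x * y)"
proof -
  obtain G where G: "finite G" "1 \<in> G" "stable_under {x, y} G"
    using stable_under_exists[of "{x, y}"] assms by auto
  have 1: "x * g \<in> zspan G" "y * g \<in> zspan G" if "g \<in> G" for g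
    using G that by (auto simp: stable_under_def)
  show "algebraic_int (x + y)"
    using 1 G by (intro algebraic_int_if_stable[of G 1]) (auto simp: distrib_right zspan_add)
  have "x * (y * g) \<in> zspan G" if "g \<in> G" for g
    by (rule zspan_mult_closed[OF 1(1) 1(2)[OF that]])
  then show "algebraic_int (x * y)"
    using G by (intro algebraic_int_if_stable[of G 1]) (auto simp: mult.assoc)
qed

lemma algebraic_int_diff:
  fixes x y :: "'a::field_char_0"
  shows "algebraic_int x \<Longrightarrow> algebraic_int y \<Longrightarrow> algebraic_int (x - y)"
  using algebraic_int_add_mult(1)[of x "- y"] by simp

lemma algebraic_int_sum:
  fixes f :: "'i \<Rightarrow> 'a::field_char_0"
  shows "(\<And>i. i \<in> A \<Longrightarrow> algebraic_int (f i)) \<Longrightarrow> algebraic_int (\<Sum>i\<in>A. f i)"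
  by (induction A rule: infinite_finite_induct) (auto intro: algebraic_int_add_mult)

lemma algebraic_int_power:
  fixes x :: "'a::field_char_0"
  shows "algebraic_int x \<Longrightarrow> algebraic_int (x ^ n)"
  by (induction n) (auto intro: algebraic_int_add_mult int_imp_algebraic_int)

text \<open>All coefficients act on one finitely generated module; adjoining the powers of
  \<open>y\<close> below \<open>n\<close> makes it stable under \<open>y\<close>.\<close>

lemma algebraic_int_integrally_closed:
  fixes y :: "'a::field_char_0"
  assumes n: "n > 0" and y: "y ^ n = (\<Sum>k<n. c k * y ^ k)"
    and c: "\<And>k. k < n \<Longrightarrow> algebraic_int (c k)"
  shows "algebraic_int y"
proof -
  obtain G where G: "finite G" "1 \<in> G" "stable_under (c ` {..<n}) G"
    using stable_under_exists[of "c ` {..<n}"] c by auto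
  then obtain H where H: "finite H" "1 \<in> H" "stable_under (insert y (c ` {..<n})) H"
    using stable_under_extend[OF G n y] by (auto simp: stable_under_def)
  then show ?thesis by (intro algebraic_int_if_stable[of H 1]) (auto simp: stable_under_def)
qed

text \<open>With \<open>a\<close> the leading coefficient and \<open>n\<close> the degree,
  multiplying the equation of \<open>r\<close> by \<open>a ^ (n - 1)\<close> gives a monic equation
  for \<open>a * r\<close> with coefficients \<open>coeff p k * a ^ (n - 1 - k)\<close>.\<close>

lemma algebraic_int_lead_coeff_times_root:
  fixes p :: "'a::field_char_0 poly"
  assumes p: "\<And>n. algebraic_int (coeff p n)" and r: "poly p r = 0"
  shows "algebraic_int (lead_coeff p * r)"
proof (cases "degree p = 0")
  case True
  with r show ?thesis by (auto elim!: degree_eq_zeroE)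
next
  case False
  define n where "n = degree p"
  define a where "a = lead_coeff p"
  have n: "n > 0" using False by (simp add: n_def)
  have "0 = a ^ (n - 1) * (\<Sum>k\<le>n. coeff p k * r ^ k)" using r by (simp add: poly_altdef n_def)
  also have "\<dots> = a ^ (n - 1) * (\<Sum>k<n. coeff p k * r ^ k) + a ^ (n - 1) * a * r ^ n"
    by (simp add: n_def a_def lessThan_Suc_atMost[symmetric] algebra_simps)
  also have "a ^ (n - 1) * a = a ^ n" using n by (metis power_minus_mult)
  also have "a ^ (n - 1) * (\<Sum>k<n. coeff p k * r ^ k) = (\<Sum>k<n. (coeff p k * a ^ (n - 1 - k)) * (a * r) ^ k)"
    unfolding sum_distrib_left
  proof (intro sum.cong refl)
    fix k assume "k \<in> {..<n}"
    then have "a ^ (n - 1) = a ^ (n - 1 - k) * a ^ k" by (simp flip: power_add)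
    then show "a ^ (n - 1) * (coeff p k * r ^ k) = (coeff p k * a ^ (n - 1 - k)) * (a * r) ^ k"
      by (simp add: power_mult_distrib mult_ac)
  qed
  finally have "(a * r) ^ n = (\<Sum>k<n. - (coeff p k * a ^ (n - 1 - k)) * (a * r) ^ k)"
    by (simp add: power_mult_distrib sum_negf eq_neg_iff_add_eq_0 add.commute)
  moreover have "algebraic_int (- (coeff p k * a ^ (n - 1 - k)))" for k
    using p by (auto intro!: algebraic_int_add_mult algebraic_int_power simp: a_def)
  ultimately have "algebraic_int (a * r)"
    using algebraic_int_integrally_closed[of n _ "\<lambda>k. - (coeff p k * a ^ (n - 1 - k))"] n by blast
  then show ?thesis by (simp add: a_def)
qed

subsection \<open>Coefficients of products\<close>

abbreviation aint_poly :: "'a::field_char_0 poly \<Rightarrow> bool" where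
  "aint_poly p \<equiv> coeffs_in (Collect algebraic_int) p"

text \<open>The leading coefficient \<open>a\<close> of \<open>q\<close> is that of the product, and
  \<open>a * s\<close> is integral because \<open>- s\<close> is a root of the product. So
  subtracting \<open>[:s, 1:] * monom a N\<close> keeps the product integral and removes the top
  term of \<open>q\<close>.\<close>

lemma aint_poly_remove_root:
  fixes q :: "'a::field_char_0 poly"
  assumes "aint_poly ([:s, 1:] * q)"
  shows "aint_poly q"
proof -
  \<comment> \<open>\<open>N\<close> bounds the number of coefficients rather than the degree, so
    that the zero polynomial is the case \<open>N = 0\<close>.\<close>
  have "aint_poly q" if "aint_poly ([:s, 1:] * q)" "\<forall>k\<ge>N. coeff q k = 0" for N and q :: "'a poly"
    using that
  proof (induction N arbitrary: q)
    case 0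
    then have "q = 0" by (intro poly_eqI) auto
    then show ?case by (simp add: coeffs_in_def)
  next
    case (Suc N)
    define a where "a = coeff q N"
    show ?case
    proof (cases "a = 0")
      case True
      then show ?thesis using Suc by (metis a_def not_less_eq_eq le_antisym)
    next
      case False
      then have deg: "degree q = N" using Suc.prems(2)
        by (intro antisym degree_le le_degree) (auto simp: a_def Suc_le_eq)
      have q0: "q \<noteq> 0" using False by (auto simp: a_def)
      have "lead_coeff ([:s, 1:] * q) = lead_coeff [:s, 1:] * lead_coeff q"
        by (rule lead_coeff_mult)
      moreover have "degree ([:s, 1:] * q) = Suc N"
        using deg q0 by (subst degree_mult_eq) auto
      ultimately have lead: "degree ([:s, 1:] * q) = Suc N" "lead_coeff ([:s, 1:] * q) = a"
        using deg by (simp_all add: a_def)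
      have a: "algebraic_int a"
        using Suc.prems(1) lead by (metis coeffs_in_def mem_Collect_eq)
      have "algebraic_int (lead_coeff ([:s, 1:] * q) * (- s))"
        using Suc.prems(1) by (intro algebraic_int_lead_coeff_times_root) (auto simp: coeffs_in_def)
      then have as: "algebraic_int (a * s)" unfolding lead(2) by simp
      define q' where "q' = q - monom a N"
      have eq: "[:s, 1:] * q' = [:s, 1:] * q - (monom (a * s) N + monom a (Suc N))"
      proof -
        have "[:s, 1:] * monom a N = monom (a * s) N + monom a (Suc N)"
          by (simp add: smult_monom monom_Suc mult.commute)
        then show ?thesis unfolding q'_def right_diff_distrib by simp
      qed
      have "aint_poly ([:s, 1:] * q')"
        unfolding coeffs_in_def mem_Collect_eq
      proof
        fix n
        have "algebraic_int (coeff ([:s, 1:] * q) n)"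
          using Suc.prems(1) unfolding coeffs_in_def by blast
        moreover have "algebraic_int (coeff (monom (a * s) N + monom a (Suc N)) n)"
          using a as by auto
        ultimately show "algebraic_int (coeff ([:s, 1:] * q') n)"
          unfolding eq coeff_diff by (rule algebraic_int_diff)
      qed
      moreover have "coeff q' k = 0" if "k \<ge> N" for k
        using Suc.prems(2) that by (cases "k = N") (auto simp: q'_def a_def)
      ultimately have "aint_poly q'" using Suc.IH[of q'] by blast
      moreover have "q = q' + monom a N" by (simp add: q'_def)
      moreover have "algebraic_int (coeff (monom a N) n)" for n using a by auto
      ultimately show ?thesis
        unfolding coeffs_in_def mem_Collect_eq by (metis algebraic_int_add_mult(1) coeff_add)
    qed
  qed
  then show ?thesis using assms coeff_eq_0[of q] by (metis Suc_le_lessD)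
qed

lemma aint_poly_remove_roots:
  fixes c :: "'a::field_char_0"
  assumes "aint_poly (smult c (\<Prod>s\<in>#A + B. [:s, 1:]))"
  shows "aint_poly (smult c (\<Prod>s\<in>#A. [:s, 1:]))"
  using assms
proof (induction B)
  case (add r B)
  have "aint_poly ([:r, 1:] * smult c (\<Prod>s\<in>#A + B. [:s, 1:]))"
    using add.prems by (simp add: mult_ac del: mult_pCons_left mult_pCons_right)
  then have "aint_poly (smult c (\<Prod>s\<in>#A + B. [:s, 1:]))" by (rule aint_poly_remove_root)
  then show ?case by (rule add.IH)
qed simp

text \<open>Linear factors are written \<open>[:s, 1:]\<close>, so the multisets hold the negated
  roots and no signs appear here.\<close>

lemma coeff_0_prod_mset_linear:
  "coeff (\<Prod>s\<in>#A. [:s, 1:]) 0 = prod_mset (A :: 'a::comm_ring_1 multiset)"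
  by (induction A) (auto simp: coeff_mult)

text \<open>The multiset \<open>C\<close> collects the roots used up by the coefficients already expanded.\<close>

lemma algebraic_int_coeff_times_coeff_aux:
  fixes c :: "'a::field_char_0"
  assumes "aint_poly (smult c (\<Prod>s\<in>#A + B + C. [:s, 1:]))"
  shows "algebraic_int (c * prod_mset C * coeff (\<Prod>s\<in>#A. [:s, 1:]) i * coeff (\<Prod>s\<in>#B. [:s, 1:]) j)"
  using assms
proof (induction A arbitrary: C i)
  case empty
  then show ?case
  proof (induction B arbitrary: C j)
    case empty
    then have "algebraic_int (c * prod_mset C)"
      using coeff_0_prod_mset_linear[of C] by (auto simp: coeffs_in_def dest: spec[of _ 0])
    then show ?case by auto
  next
    case (add s B)
    \<comment> \<open>A coefficient of the product over \<open>add_mset s B\<close> is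
      \<open>s\<close> times one over \<open>B\<close> plus another one over \<open>B\<close>. The
      first summand moves \<open>s\<close> into \<open>C\<close>, the second discards the
      factor.\<close>
    have 1: "aint_poly (smult c (\<Prod>s\<in>#{#} + B + C. [:s, 1:]))"
      using aint_poly_remove_roots[of c "B + C" "{#s#}"] add.prems by simp
    have 2: "aint_poly (smult c (\<Prod>s\<in>#{#} + B + add_mset s C. [:s, 1:]))"
      using add.prems by simp
    have "coeff (\<Prod>s\<in>#add_mset s B. [:s, 1:]) j
        = s * coeff (\<Prod>s\<in>#B. [:s, 1:]) j + (case j of 0 \<Rightarrow> 0 | Suc k \<Rightarrow> coeff (\<Prod>s\<in>#B. [:s, 1:]) k)"
      by (simp add: coeff_pCons split: nat.splits)
    then show ?case
      using add.IH[OF 1, of "j - 1"] add.IH[OF 2, of j]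
      by (cases j) (auto simp: algebra_simps intro!: algebraic_int_add_mult(1))
  qed
next
  case (add s A)
  have 1: "aint_poly (smult c (\<Prod>s\<in>#A + B + C. [:s, 1:]))"
    using aint_poly_remove_roots[of c "A + B + C" "{#s#}"] add.prems by simp
  have 2: "aint_poly (smult c (\<Prod>s\<in>#A + B + add_mset s C. [:s, 1:]))"
    using add.prems by simp
  have "coeff (\<Prod>s\<in>#add_mset s A. [:s, 1:]) i
      = s * coeff (\<Prod>s\<in>#A. [:s, 1:]) i + (case i of 0 \<Rightarrow> 0 | Suc k \<Rightarrow> coeff (\<Prod>s\<in>#A. [:s, 1:]) k)"
    by (simp add: coeff_pCons split: nat.splits)
  then show ?case
    using add.IH[OF 1, of "i - 1"] add.IH[OF 2, of i]
    by (cases i) (auto simp: algebra_simps intro!: algebraic_int_add_mult(1))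
qed

lemma complex_poly_factorization:
  fixes p :: "complex poly"
  shows "\<exists>A. p = smult (lead_coeff p) (\<Prod>s\<in>#A. [:s, 1:])"
proof (cases "p = 0")
  case False
  then obtain A where "p = smult (lead_coeff p) (\<Prod>x\<in>#A. [:- x, 1:])"
    using alg_closed_imp_factorization[of p] by auto
  then have "p = smult (lead_coeff p) (\<Prod>s\<in>#image_mset uminus A. [:s, 1:])"
    by (simp add: multiset.map_comp o_def)
  then show ?thesis by blast
qed auto

text \<open>Dedekind's form of the Gauss lemma. After both polynomials are split into linear
  factors, the product of the leading coefficients is the scalar \<open>c\<close> of the expansion
  above, which starts with \<open>C\<close> empty.\<close>

theorem algebraic_int_coeff_times_coeff:
  fixes f g :: "complex poly"
  assumes "aint_poly (f * g)"
  shows "algebraic_int (coeff f i * coeff g j)"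
proof -
  obtain A B where A: "f = smult (lead_coeff f) (\<Prod>s\<in>#A. [:s, 1:])"
    and B: "g = smult (lead_coeff g) (\<Prod>s\<in>#B. [:s, 1:])"
    using complex_poly_factorization by metis
  have "f * g = smult (lead_coeff f * lead_coeff g) (\<Prod>s\<in>#A + B + {#}. [:s, 1:])"
    by (subst A, subst B) (simp add: mult.commute)
  then have "algebraic_int ((lead_coeff f * lead_coeff g) * prod_mset {#}
      * coeff (\<Prod>s\<in>#A. [:s, 1:]) i * coeff (\<Prod>s\<in>#B. [:s, 1:]) j)"
    using assms by (intro algebraic_int_coeff_times_coeff_aux) auto
  moreover have "coeff f i = lead_coeff f * coeff (\<Prod>s\<in>#A. [:s, 1:]) i"
    "coeff g j = lead_coeff g * coeff (\<Prod>s\<in>#B. [:s, 1:]) j"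
    by (subst A, simp, subst B, simp)
  ultimately show ?thesis by (simp add: mult_ac)
qed

text \<open>Makes the Gauss lemma iterable: one factor at a time is replaced by one of its
  coefficients.\<close>

lemma aint_poly_smult_coeff:
  fixes f g :: "complex poly"
  shows "aint_poly (f * g) \<Longrightarrow> aint_poly (smult (coeff f i) g)"
  using algebraic_int_coeff_times_coeff[of f g] by (auto simp: coeffs_in_def)

corollary algebraic_int_prod_of_four_coeffs:
  fixes f1 f2 f3 f4 :: "complex poly"
  assumes "aint_poly (f1 * f2 * f3 * f4)"
  shows "algebraic_int (coeff f1 i * coeff f2 j * coeff f3 k * coeff f4 l)"
proof -
  have "aint_poly (smult (coeff f1 i) (f2 * (f3 * f4)))"
    using assms by (intro aint_poly_smult_coeff) (simp add: mult_ac)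
  then have "aint_poly (smult (coeff f1 i) f2 * (f3 * f4))" by simp
  then have "aint_poly (smult (coeff (smult (coeff f1 i) f2) j) (f3 * f4))"
    by (rule aint_poly_smult_coeff)
  then have "aint_poly (smult (coeff f1 i * coeff f2 j) f3 * f4)" by simp
  then show ?thesis using algebraic_int_coeff_times_coeff by fastforce
qed

subsection \<open>Embeddings\<close>

context
  fixes \<phi> :: "'k::field_char_0 \<Rightarrow> complex"
  assumes \<phi>: "\<phi> \<in> embeddings"
begin

lemma emb_1: "\<phi> 1 = 1" and emb_add: "\<phi> (x + y) = \<phi> x + \<phi> y" and emb_mult: "\<phi> (x * y) = \<phi> x * \<phi> y"
  using \<phi> by (auto simp: embeddings_def embedding_on_def)

lemma emb_0: "\<phi> 0 = 0"
  using emb_add[of 0 0] by simp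

lemma emb_uminus: "\<phi> (- x) = - \<phi> x"
  using emb_add[of x "- x"] by (simp add: emb_0 eq_neg_iff_add_eq_0 add.commute)

lemma emb_diff: "\<phi> (x - y) = \<phi> x - \<phi> y"
  using emb_add[of x "- y"] by (simp add: emb_uminus)

lemma emb_sum: "\<phi> (\<Sum>i\<in>A. f i) = (\<Sum>i\<in>A. \<phi> (f i))"
  by (induction A rule: infinite_finite_induct) (auto simp: emb_0 emb_add)

lemma emb_power: "\<phi> (x ^ n) = \<phi> x ^ n"
  by (induction n) (auto simp: emb_1 emb_mult)

lemma emb_of_nat: "\<phi> (of_nat n) = of_nat n"
  by (induction n) (auto simp: emb_0 emb_1 emb_add)

lemma emb_of_int: "\<phi> (of_int m) = of_int m"
  by (cases m rule: int_cases2) (auto simp: emb_of_nat emb_uminus)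

lemma emb_eq_0_iff: "\<phi> x = 0 \<longleftrightarrow> x = 0"
  using emb_mult[of x "inverse x"] by (cases "x = 0") (auto simp: emb_0 emb_1)

lemma emb_eq_iff: "\<phi> x = \<phi> y \<longleftrightarrow> x = y"
  using emb_eq_0_iff[of "x - y"] by (simp add: emb_diff)

lemma emb_inverse: "\<phi> (inverse x) = inverse (\<phi> x)"
  using emb_mult[of x "inverse x"] by (cases "x = 0") (auto simp: emb_0 emb_1 field_simps emb_eq_0_iff)

lemma emb_divide: "\<phi> (x / y) = \<phi> x / \<phi> y"
  by (simp add: divide_inverse emb_mult emb_inverse)

lemma emb_of_rat: "\<phi> (of_rat q) = of_rat q"
  by (cases q) (simp add: of_rat_rat emb_divide emb_of_int)

lemma emb_algebraic_int:
  assumes "algebraic_int x"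
  shows "algebraic_int (\<phi> x)"
proof -
  obtain p where p: "poly (map_poly of_int p) x = 0" "lead_coeff p = 1"
    using assms by (auto simp: algebraic_int_altdef_ipoly)
  have "poly (map_poly of_int p) (\<phi> x) = \<phi> (poly (map_poly of_int p) x)"
    by (simp add: poly_altdef degree_map_poly coeff_map_poly emb_sum emb_mult emb_power emb_of_int)
  then show ?thesis using p unfolding algebraic_int_altdef_ipoly by (metis emb_0)
qed

lemma emb_cnj: "(\<lambda>x. cnj (\<phi> x)) \<in> embeddings"
  by (auto simp: embeddings_def embedding_on_def emb_1 emb_add emb_mult)

end

subsection \<open>Integral bases\<close>

definition Z_independent :: "'i set \<Rightarrow> ('i \<Rightarrow> 'k::field_char_0) \<Rightarrow> bool" where
  "Z_independent S b \<longleftrightarrow>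
     (\<forall>c :: 'i \<Rightarrow> int. (\<Sum>i\<in>S. of_int (c i) * b i) = 0 \<longrightarrow> (\<forall>i\<in>S. c i = 0))"

lemma Z_independentD:
  "Z_independent S b \<Longrightarrow> (\<Sum>i\<in>S. of_int (c i) * b i) = 0 \<Longrightarrow> i \<in> S \<Longrightarrow> c i = 0"
  by (auto simp: Z_independent_def)

text \<open>Injectivity becomes independence, surjectivity becomes spanning. Extensional coefficient
  functions give way to arbitrary ones because values off \<open>S\<close> do not enter the
  sum.\<close>

lemma Z_basis_iff:
  assumes "finite S"
  shows "Z_basis S b I \<longleftrightarrow> Z_independent S b \<and>
    I = range (\<lambda>c :: 'i \<Rightarrow> int. \<Sum>i\<in>S. of_int (c i) * (b i :: 'k::field_char_0))"
proof -
  let ?f = "\<lambda>c :: 'i \<Rightarrow> int. \<Sum>i\<in>S. of_int (c i) * b i"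
  have restr: "?f (restrict c S) = ?f c" for c by (intro sum.cong) auto
  have img: "?f ` (S \<rightarrow>\<^sub>E UNIV) = range ?f"
  proof
    show "range ?f \<subseteq> ?f ` (S \<rightarrow>\<^sub>E UNIV)"
    proof
      fix x assume "x \<in> range ?f"
      then obtain c where "x = ?f c" by auto
      then have "x = ?f (restrict c S)" using restr by simp
      moreover have "restrict c S \<in> S \<rightarrow>\<^sub>E UNIV" by auto
      ultimately show "x \<in> ?f ` (S \<rightarrow>\<^sub>E UNIV)" by blast
    qed
  qed auto
  have inj: "inj_on ?f (S \<rightarrow>\<^sub>E UNIV) \<longleftrightarrow> Z_independent S b"
  proof
    assume L: "inj_on ?f (S \<rightarrow>\<^sub>E UNIV)"
    show "Z_independent S b"
      unfolding Z_independent_def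
    proof (intro allI impI ballI)
      fix c :: "'i \<Rightarrow> int" and i assume c: "?f c = 0" and i: "i \<in> S"
      have "?f (restrict c S) = ?f (restrict (\<lambda>_. 0) S)" unfolding restr using c by simp
      then have "restrict c S = restrict (\<lambda>_. 0) S"
        using L by (rule_tac inj_onD[of ?f]) auto
      then show "c i = 0" using i by (metis restrict_apply')
    qed
  next
    assume R: "Z_independent S b"
    show "inj_on ?f (S \<rightarrow>\<^sub>E UNIV)"
    proof (rule inj_onI)
      fix c d assume cd: "c \<in> S \<rightarrow>\<^sub>E UNIV" "d \<in> S \<rightarrow>\<^sub>E UNIV" "?f c = ?f d"
      then have "?f (\<lambda>i. c i - d i) = 0" by (simp add: left_diff_distrib sum_subtractf)
      then have "c i - d i = 0" if "i \<in> S" for i using Z_independentD[OF R _ that, of "\<lambda>i. c i - d i"] by simp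
      then show "c = d" using cd by (intro PiE_ext[of c S _ d]) auto
    qed
  qed
  show ?thesis by (simp only: Z_basis_def bij_betw_def img inj) auto
qed

text \<open>Serves to pass between the index type \<open>4\<close>, over which determinants are
  formed, and sets of naturals, on which symplectic bases and induction live.\<close>

lemma Z_basis_reindex:
  assumes "Z_basis S b I" "finite S" "bij_betw h T S"
  shows "Z_basis T (b \<circ> h) I"
proof -
  have fin: "finite T" using assms bij_betw_finite by blast
  have sums: "(\<Sum>i\<in>T. of_int (c (h i)) * (b \<circ> h) i) = (\<Sum>i\<in>S. of_int (c i) * b i)" for c :: "_ \<Rightarrow> int"
    using sum.reindex_bij_betw[OF assms(3), of "\<lambda>i. of_int (c i) * b i"] by simp
  define g where "g = the_inv_into T h"
  have g: "g (h i) = i" if "i \<in> T" for i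
    using that assms(3) by (auto simp: g_def bij_betw_def the_inv_into_f_f)
  have sums': "(\<Sum>i\<in>T. of_int (c i) * (b \<circ> h) i) = (\<Sum>i\<in>S. of_int (c (g i)) * b i)" for c :: "_ \<Rightarrow> int"
    using sums[of "c \<circ> g"] g by (simp cong: sum.cong)
  have "Z_independent T (b \<circ> h)"
    unfolding Z_independent_def sums'
  proof (intro allI impI ballI)
    fix c :: "_ \<Rightarrow> int" and i assume "(\<Sum>i\<in>S. of_int (c (g i)) * b i) = 0" "i \<in> T"
    then have "\<forall>i\<in>S. c (g i) = 0"
      using assms(1) Z_basis_iff[OF assms(2), of b I] Z_independentD[of S b "\<lambda>i. c (g i)"] by simp
    then show "c i = 0" using g[OF \<open>i \<in> T\<close>] \<open>i \<in> T\<close> assms(3) by (metis bij_betwE)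
  qed
  moreover have "I = range (\<lambda>c :: _ \<Rightarrow> int. \<Sum>i\<in>T. of_int (c i) * (b \<circ> h) i)"
  proof -
    have "I = range (\<lambda>c :: _ \<Rightarrow> int. \<Sum>i\<in>S. of_int (c i) * b i)"
      using assms(1) Z_basis_iff[OF assms(2), of b I] by simp
    also have "\<dots> = range (\<lambda>c :: _ \<Rightarrow> int. \<Sum>i\<in>T. of_int (c i) * (b \<circ> h) i)"
    proof (intro equalityI subsetI)
      fix x assume "x \<in> range (\<lambda>c :: _ \<Rightarrow> int. \<Sum>i\<in>S. of_int (c i) * b i)"
      then obtain c :: "_ \<Rightarrow> int" where "x = (\<Sum>i\<in>S. of_int (c i) * b i)" by blast
      then have "x = (\<Sum>i\<in>T. of_int ((c \<circ> h) i) * (b \<circ> h) i)" using sums[of c] by simp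
      then show "x \<in> range (\<lambda>c :: _ \<Rightarrow> int. \<Sum>i\<in>T. of_int (c i) * (b \<circ> h) i)" by blast
    next
      fix x assume "x \<in> range (\<lambda>c :: _ \<Rightarrow> int. \<Sum>i\<in>T. of_int (c i) * (b \<circ> h) i)"
      then obtain c :: "_ \<Rightarrow> int" where "x = (\<Sum>i\<in>T. of_int (c i) * (b \<circ> h) i)" by blast
      then have "x = (\<Sum>i\<in>S. of_int ((c \<circ> g) i) * b i)" using sums'[of c] by simp
      then show "x \<in> range (\<lambda>c :: _ \<Rightarrow> int. \<Sum>i\<in>S. of_int (c i) * b i)" by blast
    qed
    finally show ?thesis .
  qed
  ultimately show ?thesis using Z_basis_iff[OF fin] by blast
qed

text \<open>The triangular basis: \<open>h n\<close> has the least positive last coordinate among the elements of \<open>L\<close>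
  in the span of \<open>e 0, \<dots>, e n\<close>.\<close>

lemma Z_basis_sublattice:
  fixes e :: "nat \<Rightarrow> 'k::field_char_0"
  assumes "Z_independent {..<n} e" "0 \<in> L" "\<And>x y. x \<in> L \<Longrightarrow> y \<in> L \<Longrightarrow> x - y \<in> L"
    and "\<And>x. x \<in> L \<Longrightarrow> \<exists>c :: nat \<Rightarrow> int. x = (\<Sum>i<n. of_int (c i) * e i)"
    and "\<And>i. i < n \<Longrightarrow> \<exists>k > 0. of_int k * e i \<in> L"
  shows "\<exists>h. Z_basis {..<n} h L"
  using assms
proof (induction n arbitrary: L)
  case 0
  then have "L = {0}" by auto
  then show ?case by (auto simp: Z_basis_iff Z_independent_def)
next
  case (Suc n)
  have ind: "Z_independent {..<n} e"
    unfolding Z_independent_def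
  proof (intro allI impI ballI)
    fix c :: "nat \<Rightarrow> int" and i assume "(\<Sum>i<n. of_int (c i) * e i) = 0" "i \<in> {..<n}"
    then have "(\<Sum>i<Suc n. of_int ((c(n := 0)) i) * e i) = 0" by simp
    then have "(c(n := 0)) i = 0"
      using \<open>i \<in> {..<n}\<close> by (intro Z_independentD[OF Suc.prems(1)]) auto
    then show "c i = 0" using \<open>i \<in> {..<n}\<close> by auto
  qed
  have mult: "of_int m * x \<in> L" if "x \<in> L" for m x
  proof -
    have neg: "- x \<in> L" if "x \<in> L" for x using Suc.prems(3)[OF Suc.prems(2) that] by simp
    have add: "x + y \<in> L" if "x \<in> L" "y \<in> L" for x y using Suc.prems(3)[OF that(1) neg[OF that(2)]] by simp
    have nat: "of_nat k * x \<in> L" for k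
      by (induction k) (auto simp: Suc.prems(2) distrib_right intro!: add that)
    show ?thesis using nat neg by (cases m rule: int_cases2) auto
  qed
  define L' where "L' = {x \<in> L. \<exists>c :: nat \<Rightarrow> int. x = (\<Sum>i<n. of_int (c i) * e i)}"
  have "\<exists>h. Z_basis {..<n} h L'"
  proof (rule Suc.IH[OF ind])
    show "0 \<in> L'" using Suc.prems(2) by (auto simp: L'_def intro: exI[of _ "\<lambda>_. 0"])
    show "x - y \<in> L'" if xy: "x \<in> L'" "y \<in> L'" for x y
    proof -
      obtain c d :: "nat \<Rightarrow> int" where "x = (\<Sum>i<n. of_int (c i) * e i)" "y = (\<Sum>i<n. of_int (d i) * e i)"
        using xy unfolding L'_def by blast
      then have "x - y = (\<Sum>i<n. of_int (c i - d i) * e i)"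
        by (simp add: sum_subtractf left_diff_distrib)
      moreover have "x - y \<in> L" using xy by (intro Suc.prems(3)) (simp_all add: L'_def)
      ultimately show ?thesis unfolding L'_def by (intro CollectI conjI exI[of _ "\<lambda>i. c i - d i"])
    qed
    show "\<exists>c :: nat \<Rightarrow> int. x = (\<Sum>i<n. of_int (c i) * e i)" if "x \<in> L'" for x
      using that by (auto simp: L'_def)
    show "\<exists>k > 0. of_int k * e i \<in> L'" if i: "i < n" for i
    proof -
      obtain k :: int where k: "k > 0" "of_int k * e i \<in> L" using Suc.prems(5)[of i] i by auto
      have "of_int k * e i = (\<Sum>j<n. of_int (if j = i then k else 0) * e j)"
        using i by (simp add: if_distrib[of of_int] if_distrib[of "\<lambda>x. x * _"] cong: if_cong)
      then have "of_int k * e i \<in> L'"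
        using k(2) unfolding L'_def by (intro CollectI conjI exI[of _ "\<lambda>j. if j = i then k else 0"])
      then show ?thesis using k(1) by blast
    qed
  qed
  then obtain h where h: "Z_basis {..<n} h L'" by blast
  have h_ind: "Z_independent {..<n} h" and h_span: "L' = range (\<lambda>c :: nat \<Rightarrow> int. \<Sum>i<n. of_int (c i) * h i)"
    using h by (auto simp: Z_basis_iff)
  define Q where "Q = (\<lambda>k::nat. k > 0 \<and> (\<exists>c :: nat \<Rightarrow> int. c n = int k \<and> (\<Sum>i<Suc n. of_int (c i) * e i) \<in> L))"
  have "\<exists>k. Q k"
  proof -
    obtain k :: int where k: "k > 0" "of_int k * e n \<in> L" using Suc.prems(5)[of n] by auto
    have "(\<Sum>i<Suc n. of_int (((\<lambda>_. 0)(n := k)) i) * e i) = of_int k * e n" by simp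
    then have "Q (nat k)" using k by (auto simp: Q_def intro!: exI[of _ "(\<lambda>_. 0)(n := k)"])
    then show ?thesis by blast
  qed
  define m where "m = (LEAST k. Q k)"
  have "Q m" using \<open>\<exists>k. Q k\<close> unfolding m_def by (metis LeastI)
  then obtain c0 :: "nat \<Rightarrow> int" where m: "m > 0" and c0: "c0 n = int m" "(\<Sum>i<Suc n. of_int (c0 i) * e i) \<in> L"
    by (auto simp: Q_def)
  define hn where "hn = (\<Sum>i<Suc n. of_int (c0 i) * e i)"
  define h' where "h' = h(n := hn)"
  have h'_sum: "(\<Sum>i<Suc n. of_int (c i) * h' i) = (\<Sum>i<n. of_int (c i) * h i) + of_int (c n) * hn"
    for c :: "nat \<Rightarrow> int" by (simp add: h'_def)
  have L'E: "\<exists>d :: nat \<Rightarrow> int. (\<Sum>i<n. of_int (c i) * h i) = (\<Sum>i<n. of_int (d i) * e i)" for c :: "nat \<Rightarrow> int"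
  proof -
    have "(\<Sum>i<n. of_int (c i) * h i) \<in> L'" unfolding h_span by blast
    then show ?thesis by (auto simp: L'_def)
  qed
  have "Z_independent {..<Suc n} h'"
    unfolding Z_independent_def
  proof (intro allI impI)
    fix c :: "nat \<Rightarrow> int" assume "(\<Sum>i<Suc n. of_int (c i) * h' i) = 0"
    then have eq: "(\<Sum>i<n. of_int (c i) * h i) + of_int (c n) * hn = 0" by (simp only: h'_sum)
    obtain d :: "nat \<Rightarrow> int" where d: "(\<Sum>i<n. of_int (c i) * h i) = (\<Sum>i<n. of_int (d i) * e i)"
      using L'E by blast
    \<comment> \<open>In terms of \<open>e\<close>, the coordinate at \<open>n\<close> comes from
      \<open>hn\<close> alone and is \<open>c n * c0 n\<close>; the update pads \<open>d\<close>
      with a zero there.\<close>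
    have "(\<Sum>i<Suc n. of_int ((d(n := 0)) i + c n * c0 i) * e i) = (\<Sum>i<n. of_int (c i) * h i) + of_int (c n) * hn"
      unfolding d hn_def by (simp add: sum.distrib algebra_simps sum_distrib_left)
    then have "(d(n := 0)) n + c n * c0 n = 0"
      using eq by (intro Z_independentD[OF Suc.prems(1), of "\<lambda>i. (d(n := 0)) i + c n * c0 i"]) auto
    then have "c n * int m = 0" using c0(1) by simp
    then have cn: "c n = 0" using m by simp
    then have "(\<Sum>i<n. of_int (c i) * h i) = 0" using eq by simp
    then have "\<forall>i\<in>{..<n}. c i = 0" using Z_independentD[OF h_ind, of c] by blast
    then show "\<forall>i\<in>{..<Suc n}. c i = 0" using cn by (simp add: lessThan_Suc)
  qed
  moreover have "L = range (\<lambda>c :: nat \<Rightarrow> int. \<Sum>i<Suc n. of_int (c i) * h' i)"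
  proof (intro equalityI subsetI)
    fix x assume x: "x \<in> L"
    obtain c :: "nat \<Rightarrow> int" where c: "x = (\<Sum>i<Suc n. of_int (c i) * e i)" using Suc.prems(4)[OF x] by blast
    \<comment> \<open>Division with remainder: \<open>x - of_int q * hn\<close> has last coordinate
      \<open>c n mod int m\<close>, which is zero by minimality of \<open>m\<close>.\<close>
    define q where "q = c n div int m"
    have diff: "x - of_int q * hn = (\<Sum>i<Suc n. of_int (c i - q * c0 i) * e i)"
      unfolding c hn_def by (simp add: sum_subtractf left_diff_distrib right_diff_distrib distrib_left sum_distrib_left mult_ac)
    have inL: "x - of_int q * hn \<in> L"
      using x c0(2) mult Suc.prems(3) unfolding hn_def by blast
    have r: "c n - q * c0 n = c n mod int m" unfolding q_def c0(1) by (simp add: minus_div_mult_eq_mod)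
    have "c n mod int m = 0"
    proof (rule ccontr)
      assume "c n mod int m \<noteq> 0"
      then have pos: "c n mod int m > 0" using m by (simp add: order.not_eq_order_implies_strict pos_mod_sign)
      then have "Q (nat (c n mod int m))"
        unfolding Q_def using inL r unfolding diff
        by (intro conjI exI[of _ "\<lambda>i. c i - q * c0 i"]) auto
      then have "m \<le> nat (c n mod int m)" unfolding m_def by (rule Least_le)
      then show False using m pos_mod_bound[of "int m" "c n"] pos by linarith
    qed
    then have "x - of_int q * hn = (\<Sum>i<n. of_int (c i - q * c0 i) * e i)" using diff r by simp
    then have "x - of_int q * hn \<in> L'"
      using inL unfolding L'_def by (intro CollectI conjI exI[of _ "\<lambda>i. c i - q * c0 i"])
    then obtain d :: "nat \<Rightarrow> int" where "x - of_int q * hn = (\<Sum>i<n. of_int (d i) * h i)"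
      unfolding h_span by blast
    then have "x = (\<Sum>i<Suc n. of_int ((d(n := q)) i) * h' i)" unfolding h'_sum by (simp add: algebra_simps)
    then show "x \<in> range (\<lambda>c :: nat \<Rightarrow> int. \<Sum>i<Suc n. of_int (c i) * h' i)" by blast
  next
    fix x assume "x \<in> range (\<lambda>c :: nat \<Rightarrow> int. \<Sum>i<Suc n. of_int (c i) * h' i)"
    then obtain c :: "nat \<Rightarrow> int" where x: "x = (\<Sum>i<n. of_int (c i) * h i) + of_int (c n) * hn"
      using h'_sum by auto
    have "(\<Sum>i<n. of_int (c i) * h i) \<in> L" using h_span L'_def by blast
    moreover have "of_int (- c n) * hn \<in> L" using c0(2) mult unfolding hn_def by blast
    ultimately show "x \<in> L" using Suc.prems(3) unfolding x by fastforce
  qed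
  ultimately have "Z_basis {..<Suc n} h' L" by (simp only: Z_basis_iff[OF finite_lessThan])
  then show ?case by blast
qed

subsection \<open>The embedding matrix of a lattice\<close>

definition all_embs :: "(2 \<Rightarrow> 'k \<Rightarrow> complex) \<Rightarrow> 4 \<Rightarrow> 'k \<Rightarrow> complex" where
  "all_embs \<Phi> l = (if l = 1 then \<Phi> 1 else if l = 2 then \<Phi> 2
     else if l = 3 then (\<lambda>x. cnj (\<Phi> 1 x)) else (\<lambda>x. cnj (\<Phi> 2 x)))"

text \<open>Rows are field elements and columns embeddings; the squared determinant is the
  discriminant of the family \<open>b\<close>.\<close>

definition emb_mat :: "(2 \<Rightarrow> 'k \<Rightarrow> complex) \<Rightarrow> (4 \<Rightarrow> 'k) \<Rightarrow> complex^4^4" where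
  "emb_mat \<Phi> b = (\<chi> i l. all_embs \<Phi> l (b i))"

text \<open>Used for rational, integral and integral polynomial entries.\<close>

lemma det_in_subring:
  fixes A :: "'a::comm_ring_1^'n^'n"
  assumes "1 \<in> R" "0 \<in> R" "\<And>x y. x \<in> R \<Longrightarrow> y \<in> R \<Longrightarrow> x + y \<in> R" "\<And>x. x \<in> R \<Longrightarrow> - x \<in> R"
    "\<And>x y. x \<in> R \<Longrightarrow> y \<in> R \<Longrightarrow> x * y \<in> R" "\<And>i j. A $ i $ j \<in> R"
  shows "det A \<in> R"
proof -
  have prod: "(\<Prod>i\<in>S. f i) \<in> R" if "\<And>i. f i \<in> R" for f and S :: "'n set"
    by (induction S rule: infinite_finite_induct) (auto intro: assms that)
  have sum: "(\<Sum>p\<in>S. g p) \<in> R" if "\<And>p. g p \<in> R" for g and S :: "('n \<Rightarrow> 'n) set"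
    by (induction S rule: infinite_finite_induct) (auto intro: assms that)
  have sgn: "of_int (sign p) \<in> R" for p :: "'n \<Rightarrow> 'n" by (auto simp: sign_def intro: assms)
  show ?thesis unfolding det_def by (intro sum assms(5) prod sgn assms(6))
qed

lemma det_cnj: "det (\<chi> i j. cnj (A $ i $ j)) = cnj (det A)"
  by (simp add: det_def)

lemma common_denominator:
  fixes q :: "'i \<Rightarrow> rat"
  assumes "finite S"
  shows "\<exists>k::int. k > 0 \<and> (\<forall>i\<in>S. of_int k * q i \<in> \<int>)"
  using assms
proof (induction S)
  case empty
  show ?case by (intro exI[of _ 1]) simp
next
  case (insert i S)
  then obtain k :: int where k: "k > 0" "\<forall>i\<in>S. of_int k * q i \<in> \<int>" by auto
  obtain a b where "quotient_of (q i) = (a, b)" by fastforce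
  then have ab: "q i = of_int a / of_int b" "b > 0"
    using quotient_of_div quotient_of_denom_pos by auto
  have "of_int (b * k) * q j \<in> \<int>" if j: "j \<in> insert i S" for j
  proof (cases "j = i")
    case True
    then have "of_int (b * k) * q j = of_int (a * k)" using ab by (simp add: field_simps)
    then show ?thesis by (simp only: Ints_of_int)
  next
    case False
    then have "of_int k * q j \<in> \<int>" using k j by blast
    then have "of_int b * (of_int k * q j) \<in> \<int>" by (rule Ints_mult[OF Ints_of_int])
    then show ?thesis by (simp add: mult.assoc)
  qed
  then show ?case using k(1) ab(2) by (intro exI[of _ "b * k"]) simp
qed

text \<open>The data on which the arithmetic of the lattice rests. The condition
  \<open>det_nz\<close>, later read off from the symplectic relations, makes \<open>e\<close> a
  rational basis of the field.\<close>

locale CM_lattice =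
  fixes \<Phi> :: "2 \<Rightarrow> 'k::field_char_0 \<Rightarrow> complex" and \<xi> :: 'k and I :: "'k set" and e :: "4 \<Rightarrow> 'k"
  assumes CM: "CM_type \<Phi>" and Im_xi: "\<And>j. Im (\<Phi> j \<xi>) > 0"
    and deg: "degree_over_rat (UNIV :: 'k set) = 4"
    and ideal: "fractional_ideal I" and basis: "Z_basis UNIV e I"
    and det_nz: "det (emb_mat \<Phi> e) \<noteq> 0"
begin

abbreviation "\<psi> \<equiv> all_embs \<Phi>"

lemma Phi_emb: "\<Phi> j \<in> embeddings"
  using CM by (simp add: CM_type_def)

lemma psi_emb: "\<psi> l \<in> embeddings"
  using Phi_emb[of 1] Phi_emb[of 2] by (auto simp: all_embs_def intro: emb_cnj)

lemma psi_cases: "\<phi> \<in> embeddings \<Longrightarrow> \<exists>l. \<phi> = \<psi> l"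
proof -
  assume "\<phi> \<in> embeddings"
  then obtain j where j: "\<Phi> j = \<phi> \<or> \<Phi> j = (\<lambda>x. cnj (\<phi> x))" using CM unfolding CM_type_def by blast
  have "\<phi> = \<Phi> j \<or> \<phi> = (\<lambda>x. cnj (\<Phi> j x))" using j by (auto simp: fun_eq_iff)
  moreover have "j = 1 \<or> j = 2" by (rule exhaust_2)
  ultimately have "\<phi> = \<psi> 1 \<or> \<phi> = \<psi> 2 \<or> \<phi> = \<psi> 3 \<or> \<phi> = \<psi> 4" by (auto simp: all_embs_def)
  then show ?thesis by blast
qed

text \<open>The first two inequalities come from uniqueness in the CM type, the third from the
  nonreal value at \<open>\<xi>\<close>.\<close>

lemma Phi_distinct: "\<Phi> 1 \<noteq> \<Phi> 2" "\<Phi> 2 \<noteq> (\<lambda>x. cnj (\<Phi> 1 x))" "\<Phi> j \<noteq> (\<lambda>x. cnj (\<Phi> j x))"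
proof -
  have ex1: "\<exists>!j. \<Phi> j = \<Phi> 1 \<or> \<Phi> j = (\<lambda>x. cnj (\<Phi> 1 x))" using CM Phi_emb[of 1] by (simp add: CM_type_def)
  have ne: "(1::2) \<noteq> 2" by simp
  show "\<Phi> 1 \<noteq> \<Phi> 2" using ex1 ne by metis
  show "\<Phi> 2 \<noteq> (\<lambda>x. cnj (\<Phi> 1 x))" using ex1 ne by blast
  show "\<Phi> j \<noteq> (\<lambda>x. cnj (\<Phi> j x))"
  proof
    assume "\<Phi> j = (\<lambda>x. cnj (\<Phi> j x))"
    then have "\<Phi> j \<xi> = cnj (\<Phi> j \<xi>)" by metis
    then show False using Im_xi[of j] by (metis Reals_cnj_iff complex_is_Real_iff less_irrefl)
  qed
qed

lemma psi_bij: "bij_betw \<psi> UNIV embeddings"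
  unfolding bij_betw_def
proof
  have c: "(\<lambda>x. cnj (f x)) = (\<lambda>x. cnj (g x)) \<longleftrightarrow> f = g" for f g :: "'k \<Rightarrow> complex"
    by (auto simp: fun_eq_iff)
  have c': "f = (\<lambda>x. cnj (g x)) \<longleftrightarrow> g = (\<lambda>x. cnj (f x))" for f g :: "'k \<Rightarrow> complex"
    by (auto simp: fun_eq_iff)
  have d: "\<Phi> 1 \<noteq> (\<lambda>x. cnj (\<Phi> 2 x))" using Phi_distinct(2) c' by metis
  have "\<psi> 1 \<noteq> \<psi> 2" "\<psi> 1 \<noteq> \<psi> 3" "\<psi> 1 \<noteq> \<psi> 4" "\<psi> 2 \<noteq> \<psi> 3" "\<psi> 2 \<noteq> \<psi> 4" "\<psi> 3 \<noteq> \<psi> 4"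
    using Phi_distinct d by (auto simp: all_embs_def c)
  then show "inj \<psi>" unfolding inj_def forall_4 by simp
  show "range \<psi> = embeddings" using psi_emb psi_cases by blast
qed

lemma field_trace_eq: "field_trace x = (\<Sum>l\<in>UNIV. \<psi> l x)"
  unfolding field_trace_def using sum.reindex_bij_betw[OF psi_bij, of "\<lambda>\<phi>. \<phi> x"] by simp

section \<open>Rational coordinates, traces and denominators\<close>

lemma emb_mat_change:
  assumes "\<And>i. b i = (\<Sum>j\<in>UNIV. of_rat (q i j) * e' j)"
  shows "emb_mat \<Phi> b = (\<chi> i j. of_rat (q i j)) ** emb_mat \<Phi> e'"
  by (simp add: emb_mat_def matrix_matrix_mult_def vec_eq_iff assms emb_sum[OF psi_emb] emb_mult[OF psi_emb]
      emb_of_rat[OF psi_emb])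

lemma det_rat: "det ((\<chi> i j. of_rat (q i j)) :: complex^4^4) \<in> \<rat>"
  by (rule det_in_subring) auto

text \<open>A rational relation between the \<open>e i\<close> would be a kernel vector of the
  transposed embedding matrix, so they are independent, and four independent elements span a field
  of degree 4.\<close>

lemma spanning: "\<exists>q :: 4 \<Rightarrow> rat. y = (\<Sum>i\<in>UNIV. of_rat (q i) * e i)"
proof -
  interpret V: vector_space "\<lambda>(q::rat) (x::'k). of_rat q * x"
    by unfold_locales (auto simp: algebra_simps of_rat_add of_rat_mult)
  have zero: "q = (\<lambda>_. 0)" if "(\<Sum>i\<in>UNIV. of_rat (q i) * e i) = 0" for q :: "4 \<Rightarrow> rat"
  proof -
    let ?E = "transpose (emb_mat \<Phi> e)"
    let ?v = "(\<chi> i. of_rat (q i)) :: complex^4"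
    have "?E *v ?v = 0"
    proof -
      have "(\<Sum>i\<in>UNIV. \<psi> l (e i) * of_rat (q i)) = \<psi> l (\<Sum>i\<in>UNIV. of_rat (q i) * e i)" for l
        by (simp add: emb_sum[OF psi_emb] emb_mult[OF psi_emb] emb_of_rat[OF psi_emb] mult.commute)
      then show ?thesis
        by (simp add: that emb_0[OF psi_emb] vec_eq_iff matrix_vector_mult_def transpose_def emb_mat_def)
    qed
    moreover have "invertible ?E" using det_nz by (simp add: invertible_det_nz)
    then obtain B where "B ** ?E = mat 1" unfolding invertible_def by blast
    ultimately have "?v = 0" by (metis matrix_vector_mul_assoc matrix_vector_mul_lid matrix_vector_mult_0_right)
    then show ?thesis by (auto simp: vec_eq_iff)
  qed
  have inj: "inj e"
  proof (rule injI, rule ccontr)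
    fix i j assume ij: "e i = e j" "i \<noteq> j"
    define q :: "4 \<Rightarrow> rat" where "q = (\<lambda>k. if k = i then 1 else if k = j then - 1 else 0)"
    have "(\<Sum>k\<in>UNIV. of_rat (q k) * e k) = (\<Sum>k\<in>{i, j}. of_rat (q k) * e k)"
      by (rule sum.mono_neutral_right) (auto simp: q_def)
    also have "\<dots> = 0" using ij by (simp add: q_def of_rat_minus)
    finally have "q = (\<lambda>_. 0)" by (rule zero)
    then show False by (metis q_def zero_neq_one)
  qed
  have reidx: "(\<Sum>v\<in>range e. of_rat (u v) * v) = (\<Sum>i\<in>UNIV. of_rat (u (e i)) * e i)" for u :: "'k \<Rightarrow> rat"
    by (subst sum.reindex[OF inj]) simp
  have indep: "V.independent (range e)"
    unfolding V.dependent_finite[OF finite_class.finite_UNIV[THEN finite_imageI]] reidx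
  proof
    assume "\<exists>u. (\<exists>v\<in>range e. u v \<noteq> 0) \<and> (\<Sum>i\<in>UNIV. of_rat (u (e i)) * e i) = 0"
    then obtain u i where "u (e i) \<noteq> 0" "(\<Sum>i\<in>UNIV. of_rat (u (e i)) * e i) = 0" by auto
    with zero[of "u \<circ> e"] show False by (auto simp: fun_eq_iff)
  qed
  have dim: "V.dim UNIV = 4" using deg by (simp add: degree_over_rat_def)
  obtain B where B: "V.independent B" "UNIV \<subseteq> V.span B" "card B = V.dim UNIV"
    by (rule V.basis_exists[of UNIV])
  have fin: "finite B" using dim B(3) by (metis card.infinite zero_neq_numeral)
  have card_e: "card (range e) = 4" using inj by (simp add: card_image)
  have ex: "y \<in> V.span (range e)"
  proof (rule ccontr)
    assume y: "y \<notin> V.span (range e)"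
    then have ind: "V.independent (insert y (range e))" using indep by (rule V.independent_insertI)
    have "card (insert y (range e)) \<le> card B"
      by (rule V.independent_span_bound[OF fin ind subset_trans[OF subset_UNIV B(2)], THEN conjunct2])
    moreover have "y \<notin> range e" using y V.span_base[of y "range e"] by blast
    ultimately show False using card_e B(3) dim by simp
  qed
  then obtain u where "y = (\<Sum>v\<in>range e. of_rat (u v) * v)"
    unfolding V.span_finite[OF finite_class.finite_UNIV[THEN finite_imageI]] by (rule rangeE)
  then have "y = (\<Sum>i\<in>UNIV. of_rat (u (e i)) * e i)" by (rule trans[OF _ reidx])
  then show ?thesis by (rule exI[of _ "\<lambda>i. u (e i)"])
qed

lemma change_of_basis:
  obtains q :: "4 \<Rightarrow> 4 \<Rightarrow> rat" where "emb_mat \<Phi> b = (\<chi> i j. of_rat (q i j)) ** emb_mat \<Phi> e"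
    and "\<And>i. b i = (\<Sum>j\<in>UNIV. of_rat (q i j) * e j)"
proof -
  define q :: "4 \<Rightarrow> 4 \<Rightarrow> rat" where "q i = (SOME q. b i = (\<Sum>j\<in>UNIV. of_rat (q j) * e j))" for i
  have q: "b i = (\<Sum>j\<in>UNIV. of_rat (q i j) * e j)" for i
    unfolding q_def by (rule someI_ex[OF spanning])
  show ?thesis by (rule that[OF emb_mat_change[OF q] q])
qed

lemma emb_mat_scale:
  "emb_mat \<Phi> (\<lambda>i. y * b i) = emb_mat \<Phi> b ** (\<chi> l k. if l = k then \<psi> l y else 0)"
proof -
  have "\<psi> l (y * b i) = (\<Sum>k\<in>UNIV. \<psi> k (b i) * (if k = l then \<psi> k y else 0))" for i l
  proof -
    have "(\<Sum>k\<in>UNIV. \<psi> k (b i) * (if k = l then \<psi> k y else 0)) =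
        (\<Sum>k\<in>UNIV. if k = l then \<psi> k (b i) * \<psi> k y else 0)" by (intro sum.cong) auto
    then show ?thesis by (simp add: emb_mult[OF psi_emb] mult.commute)
  qed
  then show ?thesis by (simp add: emb_mat_def matrix_matrix_mult_def vec_eq_iff)
qed

text \<open>Multiplication by \<open>y\<close> has a rational matrix \<open>R\<close> in the basis
  \<open>e\<close>, and the embedding matrix conjugates it to the diagonal matrix of the conjugates
  of \<open>y\<close>; the two traces agree.\<close>

lemma trace_rat: "(\<Sum>l\<in>UNIV. \<psi> l y) \<in> \<rat>"
proof -
  obtain q where q: "emb_mat \<Phi> (\<lambda>i. y * e i) = (\<chi> i j. of_rat (q i j)) ** emb_mat \<Phi> e"
    by (rule change_of_basis)
  define D :: "complex^4^4" where "D = (\<chi> l k. if l = k then \<psi> l y else 0)"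
  define R :: "complex^4^4" where "R = (\<chi> i j. of_rat (q i j))"
  define E where "E = emb_mat \<Phi> e"
  have "emb_mat \<Phi> (\<lambda>i. y * e i) = E ** D"
    unfolding D_def E_def by (rule emb_mat_scale)
  then have eq: "E ** D = R ** E" using q by (simp add: R_def E_def)
  have "invertible E" using det_nz by (simp add: invertible_det_nz E_def)
  then obtain B where B: "B ** E = mat 1" "E ** B = mat 1" unfolding invertible_def by blast
  have "B ** (R ** E) = (B ** E) ** D" unfolding eq[symmetric] by (rule matrix_mul_assoc)
  then have "D = B ** (R ** E)" by (simp only: B matrix_mul_lid)
  then have "trace D = trace (B ** (R ** E))" by (rule arg_cong)
  also have "\<dots> = trace ((R ** E) ** B)" by (rule trace_mul_sym)
  also have "(R ** E) ** B = R" by (simp only: matrix_mul_assoc[symmetric] B matrix_mul_rid)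
  also have "trace R \<in> \<rat>" by (auto simp: trace_def R_def)
  finally show ?thesis by (simp add: trace_def D_def)
qed

lemma field_trace_Ints: "algebraic_int (y :: 'k) \<Longrightarrow> field_trace y \<in> \<int>"
  unfolding field_trace_eq
  by (rule rational_algebraic_int_is_int[OF algebraic_int_sum[OF emb_algebraic_int[OF psi_emb]] trace_rat])

text \<open>If \<open>k\<close> is a common denominator of the matrix of multiplication by
  \<open>y\<close>, then \<open>of_int k * y\<close> maps the lattice spanned by \<open>e\<close>
  into itself and is integral.\<close>

lemma clear_denominators: "\<exists>k > 0. algebraic_int (of_int k * (y :: 'k))"
proof -
  obtain q :: "4 \<Rightarrow> 4 \<Rightarrow> rat" where "emb_mat \<Phi> (\<lambda>i. y * e i) = (\<chi> i j. of_rat (q i j)) ** emb_mat \<Phi> e"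
    and q: "\<And>i. y * e i = (\<Sum>j\<in>UNIV. of_rat (q i j) * e j)"
    by (rule change_of_basis[of "\<lambda>i. y * e i"]) (rule that)
  obtain k where k: "k > 0" "\<forall>ij\<in>UNIV. of_int k * q (fst ij) (snd ij) \<in> \<int>"
    using common_denominator[of "UNIV :: (4 \<times> 4) set" "\<lambda>ij. q (fst ij) (snd ij)"] by auto
  define m where "m i j = \<lfloor>of_int k * q i j\<rfloor>" for i j
  have m: "of_int k * q i j = of_int (m i j)" for i j
  proof -
    have "of_int k * q i j \<in> \<int>" using bspec[OF k(2), of "(i, j)"] by simp
    then show ?thesis by (simp add: m_def)
  qed
  have m': "of_int k * of_rat (q i j) = (of_int (m i j) :: 'k)" for i j
    using arg_cong[OF m[of i j], of of_rat] by (simp add: of_rat_mult)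
  have e1: "e 1 \<noteq> 0"
  proof
    assume "e 1 = 0"
    then have "row 1 (emb_mat \<Phi> e) = 0" by (simp add: row_def vec_eq_iff emb_mat_def emb_0[OF psi_emb])
    then show False using det_nz det_zero_row(2) by blast
  qed
  have "algebraic_int (of_int k * y)"
  proof (rule algebraic_int_if_stable[of "range e" "e 1"])
    fix g assume "g \<in> range e"
    then obtain i where i: "g = e i" by blast
    have "of_int k * y * g = (\<Sum>j\<in>UNIV. of_int k * of_rat (q i j) * e j)"
      by (simp add: i q mult.assoc sum_distrib_left)
    also have "\<dots> = (\<Sum>j\<in>UNIV. of_int (m i j) * e j)" by (simp add: m')
    also have "\<dots> \<in> zspan (range e)" by (intro zspan_sum zspan_cmult zspan_base) auto
    finally show "of_int k * y * g \<in> zspan (range e)" .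
  qed (use e1 in auto)
  then show ?thesis using k(1) by blast
qed

end

lemma det_diag: "det ((\<chi> l k. if l = k then d l else 0) :: 'a::comm_ring_1^'n^'n) = (\<Prod>l\<in>UNIV. d l)"
  by (subst det_diagonal) auto

context CM_lattice
begin

subsection \<open>The discriminant\<close>

lemma ring_of_integers_simps:
  "0 \<in> ring_of_integers" "x \<in> ring_of_integers \<Longrightarrow> y \<in> ring_of_integers \<Longrightarrow> x - y \<in> ring_of_integers"
  "x \<in> ring_of_integers \<Longrightarrow> y \<in> ring_of_integers \<Longrightarrow> x * y \<in> ring_of_integers"
  by (simp_all add: ring_of_integers_def algebraic_int_diff algebraic_int_add_mult)

lemma ideal_mult_closed: "a \<in> ring_of_integers \<Longrightarrow> x \<in> I \<Longrightarrow> a * x \<in> I"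
  using ideal by (simp add: fractional_ideal_def)

lemma Z_basis_coords:
  assumes "Z_basis UNIV b L" "x \<in> L"
  obtains c :: "4 \<Rightarrow> int" where "x = (\<Sum>i\<in>UNIV. of_int (c i) * b i)"
proof -
  have "x \<in> range (\<lambda>c :: 4 \<Rightarrow> int. \<Sum>i\<in>UNIV. of_int (c i) * b i)"
    using assms Z_basis_iff[of UNIV b L] by simp
  then show ?thesis by (rule rangeE) (rule that)
qed

lemma Z_basis_mem:
  fixes b :: "4 \<Rightarrow> 'k"
  assumes "Z_basis UNIV b L"
  shows "b i \<in> L"
proof -
  have "b i = (\<Sum>j\<in>UNIV. of_int (if j = i then 1 else 0) * b j)"
    by (simp add: if_distrib[of of_int] if_distrib[of "\<lambda>x. x * _"] cong: if_cong)
  then have "b i \<in> range (\<lambda>c :: _ \<Rightarrow> int. \<Sum>i\<in>UNIV. of_int (c i) * b i)"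
    by (rule range_eqI[where x = "\<lambda>j. if j = i then 1 else 0"])
  then show ?thesis using assms Z_basis_iff[of UNIV b L] by simp
qed

lemma change_of_Z_basis:
  assumes "Z_basis UNIV b L" "\<And>i. b' i \<in> L"
  obtains m :: "4 \<Rightarrow> 4 \<Rightarrow> int" where "emb_mat \<Phi> b' = (\<chi> i j. of_int (m i j)) ** emb_mat \<Phi> b"
proof -
  define m :: "4 \<Rightarrow> 4 \<Rightarrow> int" where "m i = (SOME c. b' i = (\<Sum>j\<in>UNIV. of_int (c j) * b j))" for i
  have "\<exists>c :: 4 \<Rightarrow> int. b' i = (\<Sum>j\<in>UNIV. of_int (c j) * b j)" for i
    by (rule Z_basis_coords[OF assms]) (rule exI)
  then have m: "b' i = (\<Sum>j\<in>UNIV. of_int (m i j) * b j)" for i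
    unfolding m_def by (rule someI_ex)
  have "emb_mat \<Phi> b' = (\<chi> i j. of_int (m i j)) ** emb_mat \<Phi> b"
    by (simp add: emb_mat_def matrix_matrix_mult_def vec_eq_iff m emb_sum[OF psi_emb] emb_mult[OF psi_emb]
        emb_of_int[OF psi_emb])
  then show ?thesis by (rule that)
qed

lemma e_nz: "e i \<noteq> 0"
proof
  assume "e i = 0"
  then have "row i (emb_mat \<Phi> e) = 0" by (simp add: row_def vec_eq_iff emb_mat_def emb_0[OF psi_emb])
  then show False using det_nz det_zero_row(2) by blast
qed

text \<open>Since \<open>x * e 1\<close> lies in \<open>I\<close> for integral \<open>x\<close>, the
  maximal order is a sublattice of \<open>I\<close> divided by \<open>e 1\<close>, which has the
  basis \<open>e'\<close>. It has full rank because denominators can be cleared.\<close>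

lemma integral_basis_exists: "\<exists>b :: 4 \<Rightarrow> 'k. Z_basis UNIV b ring_of_integers"
proof -
  obtain h :: "nat \<Rightarrow> 4" where h: "bij_betw h {..<4} UNIV"
    using ex_bij_betw_nat_finite[of "UNIV :: 4 set"] by (auto simp: atLeast0LessThan)
  have bas: "Z_basis {..<4} (e \<circ> h) I" by (rule Z_basis_reindex[OF basis finite_class.finite_UNIV h])
  define e' where "e' = (\<lambda>i. e (h i) / e 1)"
  have e'_sum: "(\<Sum>i<4. of_int (c i) * e' i) = (\<Sum>i<4. of_int (c i) * (e \<circ> h) i) / e 1" for c :: "nat \<Rightarrow> int"
    by (simp add: e'_def sum_divide_distrib)
  have "\<exists>b. Z_basis {..<4::nat} b (ring_of_integers :: 'k set)"
  proof (rule Z_basis_sublattice[of 4 e'])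
    show "Z_independent {..<4} e'"
      unfolding Z_independent_def e'_sum
    proof (intro allI impI ballI)
      fix c :: "nat \<Rightarrow> int" and i :: nat assume "(\<Sum>i<4. of_int (c i) * (e \<circ> h) i) / e 1 = 0" and i: "i \<in> {..<4}"
      then have "(\<Sum>i<4. of_int (c i) * (e \<circ> h) i) = 0" using e_nz[of 1] by simp
      moreover have "Z_independent {..<4} (e \<circ> h)" using bas Z_basis_iff[of "{..<4}" "e \<circ> h" I] by simp
      ultimately show "c i = 0" using Z_independentD[of "{..<4}" "e \<circ> h" c i] i by simp
    qed
    show "\<exists>c :: nat \<Rightarrow> int. x = (\<Sum>i<4. of_int (c i) * e' i)" if "x \<in> ring_of_integers" for x
    proof -
      have "x * e 1 \<in> I" using that Z_basis_mem[OF basis] ideal_mult_closed by simp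
      then have "x * e 1 \<in> range (\<lambda>c :: nat \<Rightarrow> int. \<Sum>i<4. of_int (c i) * (e \<circ> h) i)"
        using bas Z_basis_iff[of "{..<4}" "e \<circ> h" I] by simp
      then obtain c :: "nat \<Rightarrow> int" where "x * e 1 = (\<Sum>i<4. of_int (c i) * (e \<circ> h) i)" by (rule rangeE)
      then have "x = (\<Sum>i<4. of_int (c i) * e' i)" unfolding e'_sum using e_nz[of 1] by (simp add: eq_divide_eq)
      then show ?thesis by (rule exI[of _ c])
    qed
    show "\<exists>k > 0. of_int k * e' i \<in> ring_of_integers" for i
      using clear_denominators[of "e' i"] by (simp add: ring_of_integers_def)
  qed (use ring_of_integers_simps in auto)
  then obtain b where "Z_basis {..<4::nat} b (ring_of_integers :: 'k set)" by blast
  moreover have "bij_betw (inv_into {..<4} h) UNIV {..<4}" using h by (rule bij_betw_inv_into)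
  ultimately have "Z_basis UNIV (b \<circ> inv_into {..<4} h) (ring_of_integers :: 'k set)"
    by (intro Z_basis_reindex) auto
  then show ?thesis by blast
qed

lemma det_int: "det ((\<chi> i j. of_int (m i j)) :: complex^4^4) \<in> \<int>"
  by (rule det_in_subring) auto

lemma trace_form_det: "det (\<chi> i j. field_trace (b' i * b' j)) = det (emb_mat \<Phi> b') ^ 2" for b' :: "4 \<Rightarrow> 'k"
proof -
  have "(\<chi> i j. field_trace (b' i * b' j)) = emb_mat \<Phi> b' ** transpose (emb_mat \<Phi> b')"
    by (simp add: vec_eq_iff matrix_matrix_mult_def transpose_def emb_mat_def field_trace_eq emb_mult[OF psi_emb])
  then show ?thesis by (simp add: det_mul power2_eq_square)
qed

context
  fixes b :: "4 \<Rightarrow> 'k"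
  assumes b: "Z_basis UNIV b ring_of_integers"
begin

text \<open>A nonzero \<open>d\<close> carries \<open>I\<close> into the maximal order, so the norm
  of \<open>d\<close> times the determinant of \<open>e\<close> is an integral multiple of the
  determinant of \<open>b\<close>.\<close>

lemma det_integral_basis_nz: "det (emb_mat \<Phi> b) \<noteq> 0"
proof -
  obtain d where d: "d \<in> ring_of_integers" "d \<noteq> 0" "\<And>x. x \<in> I \<Longrightarrow> d * x \<in> ring_of_integers"
    using ideal unfolding fractional_ideal_def by blast
  obtain m :: "4 \<Rightarrow> 4 \<Rightarrow> int" where "emb_mat \<Phi> (\<lambda>i. d * e i) = (\<chi> i j. of_int (m i j)) ** emb_mat \<Phi> b"
    by (rule change_of_Z_basis[OF b d(3)[OF Z_basis_mem[OF basis]]])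
  then have "det (emb_mat \<Phi> e) * (\<Prod>l\<in>UNIV. \<psi> l d) = det ((\<chi> i j. of_int (m i j)) :: complex^4^4) * det (emb_mat \<Phi> b)"
    unfolding emb_mat_scale by (simp only: det_mul[symmetric] det_diag[symmetric])
  moreover have "(\<Prod>l\<in>UNIV. \<psi> l d) \<noteq> 0" using d(2) by (simp add: emb_eq_0_iff[OF psi_emb])
  ultimately show ?thesis using det_nz by auto
qed

text \<open>The definite description calls for uniqueness: the integral base changes between two
  bases have determinants with product 1, hence both are 1 or both -1, and squaring removes the
  sign.\<close>

lemma discriminant_eq: "of_int (quartic_discriminant TYPE('k)) = det (emb_mat \<Phi> b) ^ 2"
proof -
  have "det (\<chi> i j. field_trace (b i * b j)) \<in> \<int>"
  proof (rule det_in_subring)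
    fix i j
    have "b i * b j \<in> ring_of_integers" using Z_basis_mem[OF b] ring_of_integers_simps(3) by blast
    then show "(\<chi> i j. field_trace (b i * b j)) $ i $ j \<in> \<int>"
      by (simp add: field_trace_Ints ring_of_integers_def)
  qed auto
  then obtain D :: int where D: "of_int D = det (\<chi> i j. field_trace (b i * b j))" by (metis Ints_cases)
  have uniq: "D' = D" if b': "Z_basis UNIV b' (ring_of_integers :: 'k set)" and D': "of_int D' = det (\<chi> i j. field_trace (b' i * b' j))"
    for b' :: "4 \<Rightarrow> 'k" and D'
  proof -
    obtain m :: "4 \<Rightarrow> 4 \<Rightarrow> int" where m: "emb_mat \<Phi> b = (\<chi> i j. of_int (m i j)) ** emb_mat \<Phi> b'"
      by (rule change_of_Z_basis[OF b' Z_basis_mem[OF b]])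
    obtain m' :: "4 \<Rightarrow> 4 \<Rightarrow> int" where m': "emb_mat \<Phi> b' = (\<chi> i j. of_int (m' i j)) ** emb_mat \<Phi> b"
      by (rule change_of_Z_basis[OF b Z_basis_mem[OF b']])
    obtain u :: int where u: "det ((\<chi> i j. of_int (m i j)) :: complex^4^4) = of_int u"
      using det_int by (metis Ints_cases)
    obtain u' :: int where u': "det ((\<chi> i j. of_int (m' i j)) :: complex^4^4) = of_int u'"
      using det_int by (metis Ints_cases)
    have 1: "det (emb_mat \<Phi> b) = of_int u * det (emb_mat \<Phi> b')"
      using arg_cong[OF m, of det] by (simp only: det_mul u)
    have 2: "det (emb_mat \<Phi> b') = of_int u' * det (emb_mat \<Phi> b)"
      using arg_cong[OF m', of det] by (simp only: det_mul u')
    have "of_int (u * u') * det (emb_mat \<Phi> b) = 1 * det (emb_mat \<Phi> b)"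
      using 1 2 by (simp add: mult.assoc)
    then have "(of_int (u * u') :: complex) = of_int 1" using det_integral_basis_nz by (metis mult_right_cancel of_int_1)
    then have "u * u' = 1" by (simp only: of_int_eq_iff)
    then have "u = 1 \<or> u = -1" unfolding zmult_eq_1_iff by blast
    then have "det (emb_mat \<Phi> b) ^ 2 = det (emb_mat \<Phi> b') ^ 2" using 1 by auto
    then have "(of_int D' :: complex) = of_int D" using D D' unfolding trace_form_det by simp
    then show ?thesis by simp
  qed
  have "quartic_discriminant TYPE('k) = D"
    unfolding quartic_discriminant_def using b D uniq by (intro the_equality) blast+
  then show ?thesis using D trace_form_det by simp
qed

lemma discriminant_nz: "quartic_discriminant TYPE('k) \<noteq> 0"
  using discriminant_eq det_integral_basis_nz by (metis of_int_0 power_not_zero)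

lemma det_ratio_rat: "det (emb_mat \<Phi> b) / det (emb_mat \<Phi> e) \<in> \<rat>"
proof -
  obtain q :: "4 \<Rightarrow> 4 \<Rightarrow> rat" where "emb_mat \<Phi> b = (\<chi> i j. of_rat (q i j)) ** emb_mat \<Phi> e"
    by (rule change_of_basis[of b])
  then have "det (emb_mat \<Phi> b) / det (emb_mat \<Phi> e) = det ((\<chi> i j. of_rat (q i j)) :: complex^4^4)"
    using det_nz by (simp add: det_mul)
  then show ?thesis using det_rat by simp
qed

end

end

lemma nonzero_Int_norm: "(z::complex) \<in> \<int> \<Longrightarrow> z \<noteq> 0 \<Longrightarrow> norm z \<ge> 1"
  by (auto simp: Ints_def norm_of_int simp flip: of_int_abs)

lemma prod_const_poly: "(\<Prod>i\<in>A. [:f i:]) = [:\<Prod>i\<in>A. f i:]"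
  by (induction A rule: infinite_finite_induct) (auto simp: one_pCons mult.commute)

lemma sum_const_poly: "(\<Sum>i\<in>A. [:f i:]) = [:\<Sum>i\<in>A. f i:]"
  by (induction A rule: infinite_finite_induct) auto

lemma det_const_poly: "det (\<chi> i j. [:A $ i $ j:]) = [:det A:]"
proof -
  have sgn: "of_int (sign p) * [:x:] = [:of_int (sign p) * x:]" for p :: "'c \<Rightarrow> 'c" and x :: 'a
    by (simp add: sign_def)
  show ?thesis unfolding det_def by (simp only: vec_lambda_beta prod_const_poly sum_const_poly sgn)
qed

lemma smult_sum_right: "smult a (\<Sum>i\<in>A. f i) = (\<Sum>i\<in>A. smult a (f i))"
  by (induction A rule: infinite_finite_induct) (auto simp: smult_add_right)

context CM_lattice
begin

subsection \<open>The norm form of the lattice\<close>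

text \<open>The powers 1, X, X^2, X^3 of a single variable stand in for four indeterminates. They
  are distinct, so every \<open>\<psi> l (e i)\<close> is still a coefficient of
  \<open>gen_poly l\<close>, and the Gauss lemma for one variable applies.\<close>

definition index_monom :: "4 \<Rightarrow> complex poly" where
  "index_monom i = monom 1 (if i = 1 then 0 else if i = 2 then 1 else if i = 3 then 2 else 3)"

definition gen_poly :: "4 \<Rightarrow> complex poly" where
  "gen_poly l = (\<Sum>i\<in>UNIV. smult (\<psi> l (e i)) (index_monom i))"

lemma coeff_gen_poly: "coeff (gen_poly l) (if i = 1 then 0 else if i = 2 then 1 else if i = 3 then 2 else 3) = \<psi> l (e i)"
proof -
  have "i = 1 \<or> i = 2 \<or> i = 3 \<or> i = 4" by (rule exhaust_4)
  then show ?thesis by (auto simp: gen_poly_def index_monom_def sum_4 coeff_eq_0)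
qed

context
  fixes b :: "4 \<Rightarrow> 'k"
  assumes b: "Z_basis UNIV b ring_of_integers"
begin

text \<open>Multiplication by the generic element \<open>\<Sum> e\<^sub>i X\<^sub>i\<close> maps the maximal order into \<open>I[X]\<close>, hence is
  given by a matrix of integral polynomials, whose determinant is the norm form up to the index.\<close>

lemma prod_gen_poly:
  "\<exists>P. coeffs_in \<int> P \<and> smult (det (emb_mat \<Phi> b)) (\<Prod>l\<in>UNIV. gen_poly l) = smult (det (emb_mat \<Phi> e)) P"
proof -
  have ex: "\<exists>c :: 4 \<Rightarrow> int. b j * e i = (\<Sum>k\<in>UNIV. of_int (c k) * e k)" for i j
    by (rule Z_basis_coords[OF basis ideal_mult_closed[OF Z_basis_mem[OF b] Z_basis_mem[OF basis]]]) (rule exI)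
  define m :: "4 \<Rightarrow> 4 \<Rightarrow> 4 \<Rightarrow> int"
    where "m j i = (SOME c. b j * e i = (\<Sum>k\<in>UNIV. of_int (c k) * e k))" for i j
  have m: "b j * e i = (\<Sum>k\<in>UNIV. of_int (m j i k) * e k)" for i j
    unfolding m_def by (rule someI_ex[OF ex])
  define M :: "complex poly^4^4" where "M = (\<chi> j k. \<Sum>i\<in>UNIV. smult (of_int (m j i k)) (index_monom i))"
  define W :: "complex poly^4^4" where "W = (\<chi> j l. [:emb_mat \<Phi> b $ j $ l:])"
  define E :: "complex poly^4^4" where "E = (\<chi> j l. [:emb_mat \<Phi> e $ j $ l:])"
  \<comment> \<open>Entry \<open>j\<close>, \<open>l\<close> of either side is the image under
    \<open>\<psi> l\<close> of \<open>b j\<close> times the generic element.\<close>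
  have "W ** (\<chi> l k. if l = k then gen_poly l else 0) = M ** E"
  proof -
    have "(\<Sum>k\<in>UNIV. W $ j $ k * (if k = l then gen_poly k else 0)) = (\<Sum>k\<in>UNIV. M $ j $ k * E $ k $ l)" for j l
    proof -
      have "(\<Sum>k\<in>UNIV. W $ j $ k * (if k = l then gen_poly k else 0)) =
          (\<Sum>k\<in>UNIV. if k = l then W $ j $ k * gen_poly k else 0)" by (intro sum.cong) auto
      also have "\<dots> = W $ j $ l * gen_poly l" by simp
      also have "\<dots> = (\<Sum>i\<in>UNIV. smult (\<psi> l (b j * e i)) (index_monom i))"
        by (simp add: W_def emb_mat_def gen_poly_def emb_mult[OF psi_emb] smult_sum_right)
      also have "\<dots> = (\<Sum>i\<in>UNIV. \<Sum>k\<in>UNIV. smult (of_int (m j i k) * \<psi> l (e k)) (index_monom i))"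
        by (simp add: m emb_sum[OF psi_emb] emb_mult[OF psi_emb] emb_of_int[OF psi_emb] smult_sum)
      also have "\<dots> = (\<Sum>k\<in>UNIV. \<Sum>i\<in>UNIV. smult (of_int (m j i k) * \<psi> l (e k)) (index_monom i))"
        by (rule sum.swap)
      also have "\<dots> = (\<Sum>k\<in>UNIV. M $ j $ k * E $ k $ l)"
        by (simp add: M_def E_def emb_mat_def sum_distrib_right mult.commute smult_sum_right)
      finally show ?thesis .
    qed
    then show ?thesis by (simp add: matrix_matrix_mult_def vec_eq_iff)
  qed
  then have "det W * (\<Prod>l\<in>UNIV. gen_poly l) = det M * det E"
    by (simp only: det_mul[symmetric] det_diag[symmetric])
  moreover have "det W = [:det (emb_mat \<Phi> b):]" "det E = [:det (emb_mat \<Phi> e):]"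
    unfolding W_def E_def by (rule det_const_poly)+
  ultimately have "smult (det (emb_mat \<Phi> b)) (\<Prod>l\<in>UNIV. gen_poly l) = smult (det (emb_mat \<Phi> e)) (det M)"
    by simp
  moreover have "det M \<in> Collect (coeffs_in \<int>)"
  proof (rule det_in_subring)
    show "M $ j $ k \<in> Collect (coeffs_in \<int>)" for j k
      by (auto simp: M_def index_monom_def coeffs_in_def coeff_sum intro!: Ints_sum)
  qed (auto simp: coeffs_in_Ints_mult, auto simp: coeffs_in_def)
  ultimately show ?thesis by blast
qed

text \<open>The ratio of determinants turns the norm form into an integral polynomial. It is
  absorbed into the first factor before the Gauss lemma is applied to the four factors.\<close>

lemma algebraic_int_four_conjugates:
  "algebraic_int (det (emb_mat \<Phi> b) / det (emb_mat \<Phi> e) * \<psi> 1 (e i) * \<psi> 2 (e j) * \<psi> 3 (e k) * \<psi> 4 (e l))"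
proof -
  define r where "r = det (emb_mat \<Phi> b) / det (emb_mat \<Phi> e)"
  obtain P where P: "coeffs_in \<int> P"
    "smult (det (emb_mat \<Phi> b)) (\<Prod>l\<in>UNIV. gen_poly l) = smult (det (emb_mat \<Phi> e)) P"
    using prod_gen_poly by blast
  have "smult (inverse (det (emb_mat \<Phi> e))) (smult (det (emb_mat \<Phi> b)) (\<Prod>l\<in>UNIV. gen_poly l)) = P"
    unfolding P(2) using det_nz by simp
  then have "smult r (\<Prod>l\<in>UNIV. gen_poly l) = P" by (simp add: r_def field_simps)
  moreover have "(\<Prod>l\<in>UNIV. gen_poly l) = gen_poly 1 * gen_poly 2 * gen_poly 3 * gen_poly 4"
    unfolding UNIV_4 by (simp add: mult_ac)
  ultimately have "smult r (gen_poly 1) * gen_poly 2 * gen_poly 3 * gen_poly 4 = P" by simp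
  moreover have "aint_poly P"
    using P(1) unfolding coeffs_in_def by (metis Ints_cases int_imp_algebraic_int mem_Collect_eq)
  ultimately have "aint_poly (smult r (gen_poly 1) * gen_poly 2 * gen_poly 3 * gen_poly 4)" by simp
  note * = algebraic_int_prod_of_four_coeffs[OF this,
      of "if i = 1 then 0 else if i = 2 then 1 else if i = 3 then 2 else 3"
         "if j = 1 then 0 else if j = 2 then 1 else if j = 3 then 2 else 3"
         "if k = 1 then 0 else if k = 2 then 1 else if k = 3 then 2 else 3"
         "if l = 1 then 0 else if l = 2 then 1 else if l = 3 then 2 else 3"]
  show ?thesis using * unfolding coeff_smult coeff_gen_poly r_def .
qed

end

subsection \<open>Two conjugate minors\<close>

text \<open>The squared modulus of the minor is written as a product with its conjugate, so that it
  expands into products of four conjugates.\<close>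

definition minorS :: "'k \<Rightarrow> 'k \<Rightarrow> complex" where
  "minorS x y = (\<Phi> 1 x * \<Phi> 2 y - \<Phi> 2 x * \<Phi> 1 y) * cnj (\<Phi> 1 x * \<Phi> 2 y - \<Phi> 2 x * \<Phi> 1 y)"

definition minorT :: "'k \<Rightarrow> 'k \<Rightarrow> complex" where
  "minorT x y = (\<Phi> 1 x * cnj (\<Phi> 2 y) - cnj (\<Phi> 2 x) * \<Phi> 1 y) * cnj (\<Phi> 1 x * cnj (\<Phi> 2 y) - cnj (\<Phi> 2 x) * \<Phi> 1 y)"

lemma minors_algebraic_int:
  assumes b: "Z_basis UNIV b ring_of_integers"
  shows "algebraic_int (det (emb_mat \<Phi> b) / det (emb_mat \<Phi> e) * minorS (e i) (e j))"
    and "algebraic_int (det (emb_mat \<Phi> b) / det (emb_mat \<Phi> e) * minorT (e i) (e j))"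
proof -
  define r where "r = det (emb_mat \<Phi> b) / det (emb_mat \<Phi> e)"
  define m where "m p q s t = r * \<psi> 1 (e p) * \<psi> 2 (e q) * \<psi> 3 (e s) * \<psi> 4 (e t)" for p q s t
  have m: "algebraic_int (m p q s t)" for p q s t
    unfolding m_def r_def by (rule algebraic_int_four_conjugates[OF b])
  \<comment> \<open>Each of the four terms of the expansion contains every embedding exactly
    once.\<close>
  have "r * minorS (e i) (e j) = (m i j i j - m i j j i) - (m j i i j - m j i j i)"
    by (simp add: m_def minorS_def all_embs_def algebra_simps)
  then show "algebraic_int (r * minorS (e i) (e j))"
    by (simp only: algebraic_int_diff m)
  have "r * minorT (e i) (e j) = (m i j i j - m i i j j) - (m j j i i - m j i j i)"
    by (simp add: m_def minorT_def all_embs_def algebra_simps)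
  then show "algebraic_int (r * minorT (e i) (e j))"
    by (simp only: algebraic_int_diff m)
qed

section \<open>Rationality and lower bounds for the minors\<close>

lemma half_trace_rat:
  assumes "\<And>j. cnj (\<Phi> j y) = \<Phi> j y"
  shows "\<Phi> 1 y + \<Phi> 2 y \<in> \<rat>"
proof -
  have eq: "\<Phi> 1 y + \<Phi> 2 y = (\<Sum>l\<in>UNIV. \<psi> l y) / 2" by (simp add: sum_4 all_embs_def assms)
  show ?thesis unfolding eq by (rule Rats_divide[OF trace_rat]) simp
qed

text \<open>Polarised norm from the real subfield: trace of \<open>y\<close> times trace of
  \<open>z\<close> minus trace of \<open>y * z\<close>.\<close>

lemma pair_rat:
  assumes "\<And>j. cnj (\<Phi> j y) = \<Phi> j y" "\<And>j. cnj (\<Phi> j z) = \<Phi> j z"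
  shows "\<Phi> 1 y * \<Phi> 2 z + \<Phi> 2 y * \<Phi> 1 z \<in> \<rat>"
proof -
  have "\<Phi> 1 y + \<Phi> 2 y \<in> \<rat>" "\<Phi> 1 z + \<Phi> 2 z \<in> \<rat>" "\<Phi> 1 (y * z) + \<Phi> 2 (y * z) \<in> \<rat>"
    by (rule half_trace_rat, simp add: assms emb_mult[OF Phi_emb])+
  then have "(\<Phi> 1 y + \<Phi> 2 y) * (\<Phi> 1 z + \<Phi> 2 z) - (\<Phi> 1 (y * z) + \<Phi> 2 (y * z)) \<in> \<rat>"
    by (intro Rats_diff Rats_mult)
  then show ?thesis by (simp add: emb_mult[OF Phi_emb] algebra_simps)
qed

context
  fixes \<kappa> :: "'k \<Rightarrow> 'k"
  assumes \<kappa>: "\<And>\<phi> x. \<phi> \<in> embeddings \<Longrightarrow> \<phi> (\<kappa> x) = cnj (\<phi> x)"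
begin

text \<open>Replacing \<open>\<Phi> 2\<close> by its conjugate exchanges the two minors. Hence their
  sum and the square of their difference are symmetric expressions in values of
  conjugation-invariant elements, namely the norms \<open>n x\<close>, \<open>n y\<close> for the
  sum, \<open>w\<close> for both minors' common cross term, and \<open>g\<close> for the difference.
  The product follows from these two.\<close>

lemma minors_rat:
  "minorS x y + minorT x y \<in> \<rat>" "minorS x y * minorT x y \<in> \<rat>"
proof -
  define n where "n = (\<lambda>x. x * \<kappa> x)"
  define w where "w = x * \<kappa> y + \<kappa> x * y"
  define g where "g = (x * \<kappa> y - \<kappa> x * y) ^ 2"
  note emb = emb_mult[OF Phi_emb] emb_add[OF Phi_emb] emb_diff[OF Phi_emb] emb_power[OF Phi_emb] \<kappa>[OF Phi_emb]
  have a: "\<Phi> 1 (n x) * \<Phi> 2 (n y) + \<Phi> 2 (n x) * \<Phi> 1 (n y) \<in> \<rat>" (is "?a \<in> _")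
    by (intro pair_rat) (simp_all add: n_def emb)
  have b: "\<Phi> 1 w * \<Phi> 2 w + \<Phi> 2 w * \<Phi> 1 w \<in> \<rat>" (is "?b \<in> _")
    by (intro pair_rat) (simp_all add: w_def emb algebra_simps)
  have c: "\<Phi> 1 g * \<Phi> 2 g + \<Phi> 2 g * \<Phi> 1 g \<in> \<rat>" (is "?c \<in> _")
    by (intro pair_rat) (simp_all add: g_def emb power2_commute)
  have add: "minorS x y + minorT x y = 2 * ?a - ?b / 2"
    by (simp add: minorS_def minorT_def n_def w_def emb algebra_simps)
  show 1: "minorS x y + minorT x y \<in> \<rat>"
    unfolding add by (rule Rats_diff[OF Rats_mult[OF Rats_number_of a] Rats_divide[OF b Rats_number_of]])
  have "minorS x y - minorT x y = (\<Phi> 1 x * cnj (\<Phi> 1 y) - cnj (\<Phi> 1 x) * \<Phi> 1 y)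
      * (\<Phi> 2 x * cnj (\<Phi> 2 y) - cnj (\<Phi> 2 x) * \<Phi> 2 y)"
    by (simp add: minorS_def minorT_def algebra_simps)
  then have diff: "(minorS x y - minorT x y) ^ 2 = ?c / 2"
    by (simp add: g_def emb power_mult_distrib)
  have prod: "minorS x y * minorT x y = ((minorS x y + minorT x y) ^ 2 - ?c / 2) / 4"
    unfolding diff[symmetric] by (simp add: power2_eq_square algebra_simps)
  show "minorS x y * minorT x y \<in> \<rat>"
    unfolding prod by (rule Rats_divide[OF Rats_diff[OF Rats_power[OF 1] Rats_divide[OF c Rats_number_of]] Rats_number_of])
qed

text \<open>A nonzero rational algebraic integer has modulus at least 1. This is applied to
  \<open>(r * s) * (r * t)\<close>, and to \<open>r * s\<close> when \<open>t = 0\<close>, since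
  \<open>s\<close> is then itself the rational sum.\<close>

lemma minors_lower_bound:
  assumes b: "Z_basis UNIV b ring_of_integers" and S: "minorS (e i) (e j) \<noteq> 0"
  defines "\<rho> \<equiv> norm (det (emb_mat \<Phi> e) / det (emb_mat \<Phi> b))"
  shows "minorT (e i) (e j) \<noteq> 0 \<Longrightarrow> \<rho>\<^sup>2 \<le> norm (minorS (e i) (e j)) * norm (minorT (e i) (e j))"
    and "minorT (e i) (e j) = 0 \<Longrightarrow> \<rho> \<le> norm (minorS (e i) (e j))"
proof -
  define r where "r = det (emb_mat \<Phi> b) / det (emb_mat \<Phi> e)"
  define s where "s = minorS (e i) (e j)"
  define t where "t = minorT (e i) (e j)"
  have r: "r \<in> \<rat>" "r \<noteq> 0" "\<rho> = inverse (norm r)"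
    using det_ratio_rat[OF b] det_nz det_integral_basis_nz[OF b]
    by (auto simp: r_def \<rho>_def norm_divide)
  have aint: "algebraic_int (r * s)" "algebraic_int (r * t)"
    using minors_algebraic_int[OF b] by (auto simp: r_def s_def t_def)
  show "\<rho>\<^sup>2 \<le> norm (minorS (e i) (e j)) * norm (minorT (e i) (e j))" if "minorT (e i) (e j) \<noteq> 0"
  proof -
    have "(r * s) * (r * t) = r * r * (s * t)" by simp
    also have "\<dots> \<in> \<rat>" using r minors_rat(2) by (auto simp: s_def t_def intro!: Rats_mult)
    finally have "(r * s) * (r * t) \<in> \<int>"
      by (rule rational_algebraic_int_is_int[OF algebraic_int_add_mult(2)[OF aint]])
    then have "norm ((r * s) * (r * t)) \<ge> 1" using that S r by (intro nonzero_Int_norm) (auto simp: s_def t_def)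
    then have "1 \<le> (norm r)\<^sup>2 * (norm s * norm t)" by (simp add: norm_mult power2_eq_square mult_ac)
    then have "inverse ((norm r)\<^sup>2) \<le> norm s * norm t" using r(2) by (simp add: field_simps)
    then show ?thesis unfolding r(3) s_def t_def by (simp add: power_inverse)
  qed
  show "\<rho> \<le> norm (minorS (e i) (e j))" if T: "minorT (e i) (e j) = 0"
  proof -
    have "s \<in> \<rat>" using minors_rat(1)[of "e i" "e j"] T by (simp add: s_def)
    then have "r * s \<in> \<int>" using r aint by (intro rational_algebraic_int_is_int) auto
    then have "norm (r * s) \<ge> 1" using S r by (intro nonzero_Int_norm) (auto simp: s_def)
    then have "inverse (norm r) \<le> norm s" using r(2) by (simp add: norm_mult field_simps)
    then show ?thesis unfolding r(3) s_def .
  qed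
qed

end

end

subsection \<open>Complex conjugation\<close>

text \<open>Over the real subfield the field is generated by some \<open>\<delta>\<close> with
  \<delta>^2 = s + t \<delta>. Under every embedding the complex conjugate of \<delta> is the other
  root, the image of \<open>t - \<delta>\<close>.\<close>

lemma CM_conj_exists:
  assumes "CM_field TYPE('k::field_char_0)"
  shows "\<exists>\<kappa> :: 'k \<Rightarrow> 'k. \<forall>\<phi>\<in>embeddings. \<forall>x. \<phi> (\<kappa> x) = cnj (\<phi> x)"
proof -
  obtain K0 :: "'k set" and u v where sub: "is_subfield K0" and tr: "totally_real K0"
    and bij: "bij_betw (\<lambda>(a, b). a * u + b * v) (K0 \<times> K0) UNIV"
    using assms unfolding CM_field_def by blast
  have nonreal: "\<not> range \<phi> \<subseteq> \<real>" if "\<phi> \<in> embeddings" for \<phi> :: "'k \<Rightarrow> complex"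
    using assms that unfolding CM_field_def by blast
  have K0: "0 \<in> K0" "1 \<in> K0" and K0_diff: "\<And>x y. x \<in> K0 \<Longrightarrow> y \<in> K0 \<Longrightarrow> x - y \<in> K0"
    and K0_mult: "\<And>x y. x \<in> K0 \<Longrightarrow> y \<in> K0 \<Longrightarrow> x * y \<in> K0" and K0_inv: "\<And>x. x \<in> K0 \<Longrightarrow> inverse x \<in> K0"
    using sub unfolding is_subfield_def by blast+
  have span: "\<exists>a\<in>K0. \<exists>b\<in>K0. x = a * u + b * v" for x
    using bij_betw_imp_surj_on[OF bij] by (force simp: image_iff set_eq_iff)
  have real: "\<phi> a \<in> \<real>" if "\<phi> \<in> embeddings" "a \<in> K0" for a and \<phi> :: "'k \<Rightarrow> complex"
  proof -
    have "embedding_on K0 \<phi>" using that(1) by (simp add: embeddings_def embedding_on_def)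
    then show ?thesis using tr that(2) unfolding totally_real_def by blast
  qed
  \<comment> \<open>Expressing 1 through \<open>u\<close> and \<open>v\<close> allows one of them to
    be exchanged for 1.\<close>
  have "\<exists>\<delta>. \<forall>x. \<exists>a\<in>K0. \<exists>b\<in>K0. x = a + b * \<delta>"
  proof -
    obtain a0 b0 where ab: "a0 \<in> K0" "b0 \<in> K0" "1 = a0 * u + b0 * v" using span by blast
    show ?thesis
    proof (cases "b0 = 0")
      case False
      have "\<exists>a\<in>K0. \<exists>b\<in>K0. x = a + b * u" for x
      proof -
        obtain a b where x: "a \<in> K0" "b \<in> K0" "x = a * u + b * v" using span by blast
        have v: "v = inverse b0 * (1 - a0 * u)" using ab(3) False by (simp add: field_simps)
        have "x = b * inverse b0 + (a - b * inverse b0 * a0) * u"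
          unfolding x(3) by (subst v) (simp add: algebra_simps)
        then show ?thesis
          using K0_mult[OF x(2) K0_inv[OF ab(2)]]
            K0_diff[OF x(1) K0_mult[OF K0_mult[OF x(2) K0_inv[OF ab(2)]] ab(1)]] by blast
      qed
      then show ?thesis by blast
    next
      case True
      have "\<exists>a\<in>K0. \<exists>b\<in>K0. x = a + b * v" for x
      proof -
        obtain a b where x: "a \<in> K0" "b \<in> K0" "x = a * u + b * v" using span by blast
        have "a0 * u = 1" using ab True by simp
        then have "u = inverse a0" by (metis inverse_unique)
        then have "x = a * inverse a0 + b * v" using x by simp
        then show ?thesis using K0_mult[OF x(1) K0_inv[OF ab(1)]] x(2) by blast
      qed
      then show ?thesis by blast
    qed
  qed
  then obtain \<delta> where \<delta>: "\<And>x. \<exists>a\<in>K0. \<exists>b\<in>K0. x = a + b * \<delta>" by blast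
  obtain s t where st: "s \<in> K0" "t \<in> K0" "\<delta> * \<delta> = s + t * \<delta>" using \<delta> by blast
  have conj_\<delta>: "\<phi> (t - \<delta>) = cnj (\<phi> \<delta>)" if \<phi>: "\<phi> \<in> embeddings" for \<phi>
  proof -
    have "\<phi> \<delta> \<notin> \<real>"
    proof
      assume d: "\<phi> \<delta> \<in> \<real>"
      have "\<phi> x \<in> \<real>" for x
      proof -
        obtain a b where "a \<in> K0" "b \<in> K0" "x = a + b * \<delta>" using \<delta> by blast
        then show ?thesis using d real[OF \<phi>] by (simp add: emb_add[OF \<phi>] emb_mult[OF \<phi>])
      qed
      then show False using nonreal[OF \<phi>] by blast
    qed
    then have ne: "\<phi> \<delta> - cnj (\<phi> \<delta>) \<noteq> 0" using Reals_cnj_iff[of "\<phi> \<delta>"] by auto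
    have 1: "\<phi> \<delta> * \<phi> \<delta> = \<phi> s + \<phi> t * \<phi> \<delta>"
      using arg_cong[OF st(3), of \<phi>] by (simp add: emb_add[OF \<phi>] emb_mult[OF \<phi>])
    have 2: "cnj (\<phi> \<delta>) * cnj (\<phi> \<delta>) = \<phi> s + \<phi> t * cnj (\<phi> \<delta>)"
      using arg_cong[OF 1, of cnj] real[OF \<phi> st(1)] real[OF \<phi> st(2)] by (simp add: Reals_cnj_iff)
    have "(\<phi> \<delta> - cnj (\<phi> \<delta>)) * (\<phi> \<delta> + cnj (\<phi> \<delta>)) = (\<phi> \<delta> - cnj (\<phi> \<delta>)) * \<phi> t"
      using 1 2 by (simp add: algebra_simps)
    then have "\<phi> \<delta> + cnj (\<phi> \<delta>) = \<phi> t" using ne by (metis mult_left_cancel)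
    then show ?thesis by (simp add: emb_diff[OF \<phi>] algebra_simps eq_diff_eq)
  qed
  have "\<exists>y. \<forall>\<phi>\<in>embeddings. \<phi> y = cnj (\<phi> x)" for x :: 'k
  proof -
    obtain a b where ab: "a \<in> K0" "b \<in> K0" "x = a + b * \<delta>" using \<delta> by blast
    have "\<phi> (a + b * (t - \<delta>)) = cnj (\<phi> x)" if "\<phi> \<in> embeddings" for \<phi>
      using real[OF that ab(1)] real[OF that ab(2)] conj_\<delta>[OF that]
      by (simp add: ab(3) emb_add[OF that] emb_mult[OF that] Reals_cnj_iff)
    then show ?thesis by blast
  qed
  then have "\<exists>\<kappa> :: 'k \<Rightarrow> 'k. \<forall>x. \<forall>\<phi>\<in>embeddings. \<phi> (\<kappa> x) = cnj (\<phi> x)" by (intro choice allI)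
  then show ?thesis by blast
qed

subsection \<open>The fundamental domain\<close>

lemma sum_UNIV_sum: "(\<Sum>i\<in>UNIV. f i) = (\<Sum>k\<in>UNIV. f (Inl k)) + (\<Sum>k\<in>UNIV. f (Inr k))"
  for f :: "'a::finite + 'b::finite \<Rightarrow> 'c::comm_monoid_add"
  by (subst UNIV_Plus_UNIV[symmetric], subst sum.Plus) auto

definition diag2 :: "int \<Rightarrow> int \<Rightarrow> int^2^2" where
  "diag2 a b = (\<chi> i j. if i = j then (if i = 1 then a else b) else 0)"

text \<open>The inversion in the first coordinate, for which the determinant of CZ + D is the entry
  z_1.\<close>

lemma partial_inversion_symplectic: "block_matrix (diag2 0 1) (diag2 (-1) 0) (diag2 1 0) (diag2 0 1) \<in> Sp4_int"
  unfolding Sp4_int_def Let_def mem_Collect_eq vec_eq_iff split_sum_all forall_2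
  by (simp add: matrix_matrix_mult_def transpose_def block_matrix_def sum_UNIV_sum sum_2 diag2_def mat_def)

text \<open>From |z_1| \<ge> 1 and |x_1| \<le> 1/2 follows y_1^2 \<ge> 3/4. Then y_12 \<le> y_1 / 2
  and y_1 \<le> y_2 give det Y \<ge> (3/4) y_1^2.\<close>

lemma fundamental_domain_bounds:
  assumes "Z \<in> siegel_fundamental_domain"
  shows "Im (Z $ 1 $ 1) > 0"
    and "Im (Z $ 1 $ 1) * Im (Z $ 2 $ 2) - (Im (Z $ 1 $ 2))\<^sup>2 \<ge> 9 / 16"
proof -
  let ?y1 = "Im (Z $ 1 $ 1)" and ?y2 = "Im (Z $ 2 $ 2)" and ?y12 = "Im (Z $ 1 $ 2)" and ?x1 = "Re (Z $ 1 $ 1)"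
  have x1: "- 1 / 2 \<le> ?x1" "?x1 < 1 / 2" and y: "0 \<le> 2 * ?y12" "2 * ?y12 \<le> ?y1" "?y1 \<le> ?y2"
    and S3: "\<And>A B C D. block_matrix A B C D \<in> Sp4_int \<Longrightarrow>
        cmod (det (map_matrix of_int C ** Z + map_matrix of_int D)) \<ge> 1"
    using assms by (auto simp: siegel_fundamental_domain_def)
  have "det (map_matrix of_int (diag2 1 0) ** Z + map_matrix of_int (diag2 0 1)) = Z $ 1 $ 1"
    by (simp add: det_2 matrix_matrix_mult_def sum_2 diag2_def map_matrix_def)
  then have "cmod (Z $ 1 $ 1) \<ge> 1" using S3[OF partial_inversion_symplectic] by simp
  then have "1 \<le> (cmod (Z $ 1 $ 1))\<^sup>2" by simp
  then have "1 \<le> ?x1\<^sup>2 + ?y1\<^sup>2" by (simp add: cmod_power2)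
  moreover have "?x1\<^sup>2 \<le> (1 / 2)\<^sup>2" using x1 by (intro power2_le_iff_abs_le[THEN iffD2]) auto
  ultimately have y1: "?y1\<^sup>2 \<ge> 3 / 4" by (simp add: power2_eq_square)
  then have "?y1 \<noteq> 0" by auto
  then show "?y1 > 0" using y by linarith
  have "?y12\<^sup>2 \<le> (?y1 / 2)\<^sup>2" using y by (intro power_mono) auto
  moreover have "?y1 * ?y1 \<le> ?y1 * ?y2" using y by (intro mult_left_mono) auto
  ultimately show "?y1 * ?y2 - ?y12\<^sup>2 \<ge> 9 / 16" using y1 by (simp add: power2_eq_square)
qed

subsection \<open>Period relations\<close>

text \<open>Let G be the Gram matrix of the two vectors \<open>a\<close>, \<open>b\<close> for the
  Hermitian form with weights \<open>t1\<close>, \<open>t2\<close>, with diagonal \<open>g\<close>,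
  \<open>h\<close> and off-diagonal real part \<open>p\<close> and imaginary part \<open>r\<close>.
  The first relation makes G real, the other four say 2 Y G = 1, and determinants are taken.\<close>

lemma period_relations:
  fixes a1 a2 b1 b2 z1 z12 z2 :: complex and t1 t2 :: real
  defines "E \<equiv> \<lambda>x1 x2 w1 w2. 2 * (t1 * Im (cnj x1 * w1) + t2 * Im (cnj x2 * w2))"
  assumes E12: "E a1 a2 b1 b2 = 0"
    and E13: "E a1 a2 (z1 * a1 + z12 * b1) (z1 * a2 + z12 * b2) = 1"
    and E14: "E a1 a2 (z12 * a1 + z2 * b1) (z12 * a2 + z2 * b2) = 0"
    and E23: "E b1 b2 (z1 * a1 + z12 * b1) (z1 * a2 + z12 * b2) = 0"
    and E24: "E b1 b2 (z12 * a1 + z2 * b1) (z12 * a2 + z2 * b2) = 1"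
  shows "4 * (t1 * t2 * (cmod (a1 * b2 - a2 * b1))\<^sup>2) * (Im z1 * Im z2 - (Im z12)\<^sup>2) = 1"
proof -
  define g where "g = t1 * (cmod a1)\<^sup>2 + t2 * (cmod a2)\<^sup>2"
  define h where "h = t1 * (cmod b1)\<^sup>2 + t2 * (cmod b2)\<^sup>2"
  define p where "p = t1 * Re (cnj a1 * b1) + t2 * Re (cnj a2 * b2)"
  define r where "r = t1 * Im (cnj a1 * b1) + t2 * Im (cnj a2 * b2)"
  have r: "r = 0" using E12 by (simp add: E_def r_def)
  have "E a1 a2 (z1 * a1 + z12 * b1) (z1 * a2 + z12 * b2) = 2 * (Im z1 * g + Im z12 * p + Re z12 * r)"
    unfolding E_def g_def p_def r_def cmod_power2 by (simp add: power2_eq_square algebra_simps)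
  then have 1: "2 * (Im z1 * g + Im z12 * p) = 1" using E13 r by simp
  have "E a1 a2 (z12 * a1 + z2 * b1) (z12 * a2 + z2 * b2) = 2 * (Im z12 * g + Im z2 * p + Re z2 * r)"
    unfolding E_def g_def p_def r_def cmod_power2 by (simp add: power2_eq_square algebra_simps)
  then have 2: "Im z12 * g + Im z2 * p = 0" using E14 r by simp
  have "E b1 b2 (z1 * a1 + z12 * b1) (z1 * a2 + z12 * b2) = 2 * (Im z1 * p + Im z12 * h - Re z1 * r)"
    unfolding E_def h_def p_def r_def cmod_power2 by (simp add: power2_eq_square algebra_simps)
  then have 3: "Im z1 * p + Im z12 * h = 0" using E23 r by simp
  have "E b1 b2 (z12 * a1 + z2 * b1) (z12 * a2 + z2 * b2) = 2 * (Im z12 * p + Im z2 * h - Re z12 * r)"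
    unfolding E_def h_def p_def r_def cmod_power2 by (simp add: power2_eq_square algebra_simps)
  then have 4: "2 * (Im z12 * p + Im z2 * h) = 1" using E24 r by simp
  \<comment> \<open>Lagrange's identity for the Gram determinant of two vectors in C^2.\<close>
  have "g * h - p\<^sup>2 - r\<^sup>2 = t1 * t2 * (cmod (a1 * b2 - a2 * b1))\<^sup>2"
    unfolding g_def h_def p_def r_def cmod_power2 by (simp add: power2_eq_square algebra_simps)
  then have det: "t1 * t2 * (cmod (a1 * b2 - a2 * b1))\<^sup>2 = g * h - p\<^sup>2" using r by simp
  have "4 * (g * h - p\<^sup>2) * (Im z1 * Im z2 - (Im z12)\<^sup>2) =
      (2 * (Im z1 * g + Im z12 * p)) * (2 * (Im z12 * p + Im z2 * h))
      - 4 * (Im z12 * g + Im z2 * p) * (Im z1 * p + Im z12 * h)"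
    by (simp add: power2_eq_square algebra_simps)
  then show ?thesis unfolding det 1 4 2 by simp
qed

text \<open>The two squares differ by 4uv, where t_1 u and t_2 v have sum 1/2, hence product at most
  1/16.\<close>

lemma minors_comparison:
  fixes a1 a2 c1 c2 :: complex and t1 t2 :: real
  assumes t: "t1 > 0" "t2 > 0" and E: "2 * (t1 * Im (cnj a1 * c1) + t2 * Im (cnj a2 * c2)) = 1"
  shows "(cmod (a1 * cnj c2 - cnj a2 * c1))\<^sup>2 \<le> (cmod (a1 * c2 - a2 * c1))\<^sup>2 + 1 / (4 * (t1 * t2))"
proof -
  define u where "u = Im (cnj a1 * c1)"
  define v where "v = Im (cnj a2 * c2)"
  have "(cmod (a1 * cnj c2 - cnj a2 * c1))\<^sup>2 = (cmod (a1 * c2 - a2 * c1))\<^sup>2 + 4 * (u * v)"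
    unfolding u_def v_def cmod_power2 by (simp add: power2_eq_square algebra_simps)
  moreover have "16 * (t1 * u) * (t2 * v) \<le> 1"
  proof -
    have "t2 * v = 1 / 2 - t1 * u" using E by (simp add: u_def v_def)
    then have eq: "16 * (t1 * u) * (t2 * v) = 16 * (t1 * u) * (1 / 2 - t1 * u)" by simp
    have "0 \<le> (4 * (t1 * u) - 1)\<^sup>2" by simp
    then show ?thesis unfolding eq by (simp add: power2_eq_square algebra_simps)
  qed
  then have "4 * (u * v) \<le> 1 / (4 * (t1 * t2))" using t by (simp add: field_simps)
  ultimately show ?thesis by simp
qed

text \<open>For smaller \<open>s\<close> the second factor is below 1, so the product would be at
  most \<open>s\<close>, hence below \<open>1 / d\<close>. The constant 16/81 is the one needed
  later: 4 (16/81) (9/16) = (2/3)^2.\<close>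

lemma final_estimate:
  fixes s d :: real
  assumes "d \<ge> 1" "s \<ge> 0" "s * (s + 1 / 4) \<ge> 1 / d"
  shows "s \<ge> 16 / (81 * d)"
proof (rule ccontr)
  assume "\<not> ?thesis"
  then have s: "s < 16 / (81 * d)" by simp
  have "16 / (81 * d) \<le> 16 / 81" using assms(1) by (simp add: field_simps)
  then have "s + 1 / 4 < 1" using s by linarith
  then have "s * (s + 1 / 4) \<le> s" using assms(2) by (intro mult_left_le) auto
  moreover have "16 / (81 * d) \<le> 1 / d" using assms(1) by (simp add: field_simps)
  ultimately show False using assms(3) s by linarith
qed

subsection \<open>Symplectic bases\<close>

text \<open>Arithmetic in the type \<open>4\<close> is modulo 4, so the conditions
  \<open>j = i + 2\<close> of a symplectic basis have to be read on the representatives 1 to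
  4.\<close>

definition four_index :: "4 \<Rightarrow> nat" where
  "four_index i = (if i = 1 then 1 else if i = 2 then 2 else if i = 3 then 3 else 4)"

lemma four_index_simps [simp]:
  "four_index 1 = 1" "four_index 2 = 2" "four_index 3 = 3" "four_index 4 = 4"
  by (simp_all add: four_index_def)

lemma four_index_bij: "bij_betw four_index UNIV {1..4}"
  unfolding bij_betw_def
proof
  show "inj four_index" unfolding inj_def forall_4 by simp
  have "{1..4} = {1, 2, 3, 4::nat}" by auto
  then show "range four_index = {1..4}" unfolding UNIV_4 by simp
qed

lemma riemann_form_eq:
  assumes "\<And>j. Re (\<Phi> j \<xi>) = 0"
  shows "riemann_form \<Phi> \<xi> (CM_vec \<Phi> x) (CM_vec \<Phi> y) =
    of_real (2 * (Im (\<Phi> 1 \<xi>) * Im (cnj (\<Phi> 1 x) * \<Phi> 1 y) + Im (\<Phi> 2 \<xi>) * Im (cnj (\<Phi> 2 x) * \<Phi> 2 y)))"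
  by (simp add: riemann_form_def CM_vec_def sum_2 complex_eq_iff assms algebra_simps)

text \<open>As \<open>\<xi>\<close> is imaginary, the subtracted terms belong to the conjugate
  embeddings. The Gram matrix of the form thus factors through the embedding matrix.\<close>

lemma riemann_form_all_embs:
  assumes "\<And>j. cnj (\<Phi> j \<xi>) = - \<Phi> j \<xi>"
  shows "riemann_form \<Phi> \<xi> (CM_vec \<Phi> x) (CM_vec \<Phi> y) =
    (\<Sum>l\<in>UNIV. all_embs \<Phi> l x * all_embs \<Phi> l \<xi> * cnj (all_embs \<Phi> l y))"
  by (simp add: riemann_form_def CM_vec_def sum_2 sum_4 all_embs_def assms algebra_simps)

text \<open>Determinants in M D M* = J, where D is diagonal with the conjugates of
  \<open>\<xi>\<close> and |det J| = 1.\<close>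

lemma det_symplectic:
  fixes e :: "4 \<Rightarrow> 'k::field_char_0"
  assumes xi: "\<And>j. Re (\<Phi> j \<xi>) = 0"
    and E: "\<And>i j. riemann_form \<Phi> \<xi> (CM_vec \<Phi> (e i)) (CM_vec \<Phi> (e j)) =
      (if four_index j = four_index i + 2 then 1 else if four_index i = four_index j + 2 then -1 else 0)"
  shows "cmod (det (emb_mat \<Phi> e)) * \<bar>Im (\<Phi> 1 \<xi>) * Im (\<Phi> 2 \<xi>)\<bar> = 1"
proof -
  define M where "M = emb_mat \<Phi> e"
  define D :: "complex^4^4" where "D = (\<chi> l k. if l = k then all_embs \<Phi> l \<xi> else 0)"
  define N :: "complex^4^4" where "N = (\<chi> i l. cnj (M $ i $ l))"
  define J :: "complex^4^4" where "J = (\<chi> i j. if four_index j = four_index i + 2 then 1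
    else if four_index i = four_index j + 2 then -1 else 0)"
  have cnj_xi: "cnj (\<Phi> j \<xi>) = - \<Phi> j \<xi>" for j by (simp add: complex_eq_iff xi)
  have MD: "(M ** D) $ i $ l = all_embs \<Phi> l (e i) * all_embs \<Phi> l \<xi>" for i l
  proof -
    have "(M ** D) $ i $ l = (\<Sum>k\<in>UNIV. if k = l then all_embs \<Phi> k (e i) * all_embs \<Phi> k \<xi> else 0)"
      unfolding matrix_matrix_mult_def M_def D_def emb_mat_def vec_lambda_beta by (intro sum.cong) auto
    then show ?thesis by simp
  qed
  have "M ** D ** transpose N = J"
    unfolding vec_eq_iff
  proof (intro allI)
    fix i j
    have "(M ** D ** transpose N) $ i $ j = (\<Sum>l\<in>UNIV. (M ** D) $ i $ l * N $ j $ l)"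
      by (simp add: matrix_matrix_mult_def[of "M ** D"] transpose_def)
    also have "\<dots> = riemann_form \<Phi> \<xi> (CM_vec \<Phi> (e i)) (CM_vec \<Phi> (e j))"
      unfolding riemann_form_all_embs[of \<Phi> \<xi>, OF cnj_xi] MD by (simp add: N_def M_def emb_mat_def)
    also have "\<dots> = J $ i $ j" unfolding E J_def by simp
    finally show "(M ** D ** transpose N) $ i $ j = J $ i $ j" .
  qed
  then have "det M * det D * det N = det J"
    by (metis det_mul det_transpose)
  moreover have "det D = of_real ((Im (\<Phi> 1 \<xi>) * Im (\<Phi> 2 \<xi>))\<^sup>2)"
  proof -
    have xi': "\<Phi> j \<xi> = \<i> * of_real (Im (\<Phi> j \<xi>))" for j by (simp add: complex_eq_iff xi)
    have "det D = \<Phi> 1 \<xi> * \<Phi> 2 \<xi> * (- \<Phi> 1 \<xi>) * (- \<Phi> 2 \<xi>)"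
      unfolding D_def det_diag UNIV_4 by (simp add: all_embs_def cnj_xi)
    also have "\<dots> = (\<i> * of_real (Im (\<Phi> 1 \<xi>)))\<^sup>2 * (\<i> * of_real (Im (\<Phi> 2 \<xi>)))\<^sup>2"
      unfolding xi'[symmetric] by (simp add: power2_eq_square)
    also have "\<dots> = of_real ((Im (\<Phi> 1 \<xi>) * Im (\<Phi> 2 \<xi>))\<^sup>2)"
      by (simp add: power_mult_distrib)
    finally show ?thesis .
  qed
  moreover have "det N = cnj (det M)" unfolding N_def by (rule det_cnj)
  moreover have "cmod (det J) = 1"
  proof -
    have "J ** transpose J = mat 1"
      unfolding vec_eq_iff forall_4
      by (simp add: J_def matrix_matrix_mult_def transpose_def mat_def sum_4)
    then have "det J * det J = 1" by (metis det_I det_mul det_transpose)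
    then have "cmod (det J) * cmod (det J) = 1" by (metis norm_mult norm_one)
    then show ?thesis by (metis abs_norm_cancel power2_eq_1_iff power2_eq_square abs_minus_cancel abs_one)
  qed
  ultimately have "cmod (det M * of_real ((Im (\<Phi> 1 \<xi>) * Im (\<Phi> 2 \<xi>))\<^sup>2) * cnj (det M)) = 1"
    by simp
  then have "cmod (det M) * (Im (\<Phi> 1 \<xi>) * Im (\<Phi> 2 \<xi>))\<^sup>2 * cmod (det M) = 1"
    unfolding norm_mult complex_mod_cnj norm_of_real abs_power2 .
  then have "(cmod (det M) * \<bar>Im (\<Phi> 1 \<xi>) * Im (\<Phi> 2 \<xi>)\<bar>)\<^sup>2 = 1"
    unfolding power_mult_distrib[of "cmod (det M)"] power2_abs by (simp add: power2_eq_square mult_ac)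
  moreover have "cmod (det M) * \<bar>Im (\<Phi> 1 \<xi>) * Im (\<Phi> 2 \<xi>)\<bar> \<ge> 0" by simp
  ultimately show ?thesis unfolding M_def power2_eq_1_iff by linarith
qed

subsection \<open>Cyclic fields\<close>

lemma real_quadratic_irrational:
  fixes F :: "'k::field_char_0 set"
  assumes "real_quadratic_field F"
  shows "\<exists>x\<in>F. x \<notin> \<rat>"
proof (rule ccontr)
  assume "\<not> ?thesis"
  then have F: "F \<subseteq> \<rat>" by blast
  interpret V: vector_space "\<lambda>(q::rat) (x::'k). of_rat q * x"
    by unfold_locales (auto simp: algebra_simps of_rat_add of_rat_mult)
  have dim: "V.dim F = 2" using assms by (simp add: real_quadratic_field_def degree_over_rat_def)
  obtain B where B: "B \<subseteq> F" "V.independent B" "card B = V.dim F"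
    by (rule V.basis_exists[of F])
  have "B \<subseteq> V.span {1}"
  proof
    fix x assume "x \<in> B"
    then have "x \<in> \<rat>" using B(1) F by blast
    then obtain q :: rat where q: "x = of_rat q" by (rule Rats_cases)
    have "of_rat q * 1 \<in> V.span {1}" by (rule V.span_scale[OF V.span_base]) simp
    then show "x \<in> V.span {1}" using q by simp
  qed
  then have "card B \<le> card {1::'k}"
    by (rule V.independent_span_bound[OF finite.intros(2)[OF finite.intros(1)] B(2), THEN conjunct2])
  then show False using B(3) dim by simp
qed

lemma funpow_fixed: "\<sigma> x = x \<Longrightarrow> (\<sigma> ^^ n) x = x"
  by (induction n) auto

lemma funpow_involution:
  assumes "\<sigma> (\<sigma> x) = x"
  shows "(\<sigma> ^^ n) x = (if even n then x else \<sigma> x)"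
  by (induction n) (auto simp: assms)

context CM_lattice
begin

text \<open>The generator \<open>\<sigma>\<close> of the automorphism group would have to map \<open>q\<close> to its conjugate, so complex
  conjugation would be an odd power of \<open>\<sigma>\<close>; but it is the identity on \<open>F\<close>, hence an even power.\<close>

lemma cyclic_no_imaginary_quadratic:
  fixes F :: "'k set" and \<kappa> :: "'k \<Rightarrow> 'k"
  assumes F: "real_quadratic_field F" and gal: "galois_over_rat TYPE('k)" and cyc: "cyclic_auts TYPE('k)"
    and \<kappa>: "\<And>\<phi> x. \<phi> \<in> embeddings \<Longrightarrow> \<phi> (\<kappa> x) = cnj (\<phi> x)"
    and q: "\<And>j. \<Phi> j q = z" and z: "Im z \<noteq> 0"
  shows False
proof -
  note inj = emb_eq_iff[OF Phi_emb[of 1]]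
  have kk: "\<kappa> (\<kappa> x) = x" for x
    using inj[of "\<kappa> (\<kappa> x)" x] \<kappa>[OF Phi_emb[of 1]] by simp
  have "\<kappa> \<in> field_auts"
    unfolding field_auts_def mem_Collect_eq
  proof (intro conjI allI)
    show "bij \<kappa>" by (rule bijI'[of \<kappa>]) (metis kk)+
    show "\<kappa> (x + y) = \<kappa> x + \<kappa> y" for x y
      using inj[of "\<kappa> (x + y)" "\<kappa> x + \<kappa> y"] by (simp add: \<kappa>[OF Phi_emb] emb_add[OF Phi_emb])
    show "\<kappa> (x * y) = \<kappa> x * \<kappa> y" for x y
      using inj[of "\<kappa> (x * y)" "\<kappa> x * \<kappa> y"] by (simp add: \<kappa>[OF Phi_emb] emb_mult[OF Phi_emb])
  qed
  then obtain \<sigma> :: "'k \<Rightarrow> 'k" and m where \<sigma>: "\<sigma> \<in> field_auts" "\<And>\<tau>. \<tau> \<in> field_auts \<Longrightarrow> \<exists>n. \<tau> = \<sigma> ^^ n"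
    and m: "\<kappa> = \<sigma> ^^ m"
    using cyc unfolding cyclic_auts_def by blast
  have \<sigma>_emb: "(\<lambda>x. \<phi> (\<sigma> x)) \<in> embeddings" if \<phi>: "\<phi> \<in> embeddings" for \<phi>
  proof -
    have hom: "\<sigma> (x + y) = \<sigma> x + \<sigma> y" "\<sigma> (x * y) = \<sigma> x * \<sigma> y" for x y
      using \<sigma>(1) by (auto simp: field_auts_def)
    have "inj \<sigma>" using \<sigma>(1) by (auto simp: field_auts_def bij_def)
    moreover have "\<sigma> 0 = 0" using hom(1)[of 0 0] by simp
    ultimately have "\<sigma> 1 \<noteq> 0" by (metis injD zero_neq_one)
    then have "\<sigma> 1 = 1" using hom(2)[of 1 1] by simp
    then show ?thesis
      using hom by (simp add: embeddings_def embedding_on_def emb_1[OF \<phi>] emb_add[OF \<phi>] emb_mult[OF \<phi>])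
  qed
  have val: "\<exists>k. (\<forall>x. \<Phi> j (\<sigma> x) = \<Phi> k x) \<or> (\<forall>x. \<Phi> j (\<sigma> x) = cnj (\<Phi> k x))" for j
  proof -
    obtain l where "(\<lambda>x. \<Phi> j (\<sigma> x)) = \<psi> l" using psi_cases[OF \<sigma>_emb[OF Phi_emb]] by blast
    then have "\<Phi> j (\<sigma> x) = \<psi> l x" for x by (rule fun_cong)
    then show ?thesis unfolding all_embs_def by (auto split: if_splits)
  qed
  have "\<kappa> q \<noteq> q"
  proof
    assume "\<kappa> q = q"
    then have "cnj z = z" using \<kappa>[OF Phi_emb[of 1], of q] q by simp
    then show False using z by (simp add: complex_eq_iff)
  qed
  then have sq: "\<sigma> q \<noteq> q" using funpow_fixed[of \<sigma> q m] m by auto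
  \<comment> \<open>All four embeddings send \<open>q\<close> to \<open>z\<close> or its conjugate,
    so these are the only possible values.\<close>
  have "\<Phi> 1 (\<sigma> q) = \<Phi> 1 q \<or> \<Phi> 1 (\<sigma> q) = \<Phi> 1 (\<kappa> q)"
    using val[of 1] q \<kappa>[OF Phi_emb[of 1], of q] by auto
  then have "\<sigma> q = \<kappa> q" using sq inj by blast
  moreover have "\<sigma> (\<kappa> q) = \<kappa> (\<sigma> q)" unfolding m by (rule funpow_swap1)
  ultimately have "\<sigma> (\<sigma> q) = q" using kk by simp
  then have odd: "odd m" using funpow_involution[of \<sigma> q m] m \<open>\<kappa> q \<noteq> q\<close> by auto
  obtain x where x: "x \<in> F" "x \<notin> \<rat>" using real_quadratic_irrational[OF F] by blast
  have real: "cnj (\<Phi> j x) = \<Phi> j x" for j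
  proof -
    have "embedding_on F (\<Phi> j)" using Phi_emb[of j] by (simp add: embeddings_def embedding_on_def)
    then have "\<Phi> j x \<in> \<real>" using F x(1) unfolding real_quadratic_field_def totally_real_def by blast
    then show ?thesis by (simp add: Reals_cnj_iff)
  qed
  have kx: "\<kappa> x = x" using inj[of "\<kappa> x" x] real \<kappa>[OF Phi_emb[of 1]] by simp
  have sx: "\<sigma> x \<noteq> x"
  proof
    assume "\<sigma> x = x"
    then have "\<forall>\<tau>\<in>field_auts. \<tau> x = x" using \<sigma>(2) funpow_fixed[of \<sigma> x] by metis
    then show False using gal x(2) unfolding galois_over_rat_def by blast
  qed
  \<comment> \<open>Since \<open>\<sigma>\<close> moves \<open>x\<close>, composing with it
    exchanges the two real values of \<open>x\<close>; doing so twice brings back the first, so the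
    square of \<open>\<sigma>\<close> fixes \<open>x\<close>.\<close>
  have step: "\<exists>k. k \<noteq> j \<and> \<Phi> j (\<sigma> x) = \<Phi> k x \<and> (\<Phi> j (\<sigma> (\<sigma> x)) = \<Phi> k (\<sigma> x) \<or> \<Phi> j (\<sigma> (\<sigma> x)) = cnj (\<Phi> k (\<sigma> x)))" for j
  proof -
    obtain k where k: "(\<forall>x. \<Phi> j (\<sigma> x) = \<Phi> k x) \<or> (\<forall>x. \<Phi> j (\<sigma> x) = cnj (\<Phi> k x))" using val by blast
    then have 1: "\<Phi> j (\<sigma> x) = \<Phi> k x" using real by auto
    then have "k \<noteq> j" using sx emb_eq_iff[OF Phi_emb[of j]] by auto
    then show ?thesis using k 1 by blast
  qed
  obtain k where k: "k \<noteq> 1" "\<Phi> 1 (\<sigma> (\<sigma> x)) = \<Phi> k (\<sigma> x) \<or> \<Phi> 1 (\<sigma> (\<sigma> x)) = cnj (\<Phi> k (\<sigma> x))"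
    using step[of 1] by blast
  obtain l where l: "l \<noteq> k" "\<Phi> k (\<sigma> x) = \<Phi> l x" using step[of k] by blast
  have "l = 1" using k(1) l(1) exhaust_2[of k] exhaust_2[of l] by auto
  then have "\<Phi> 1 (\<sigma> (\<sigma> x)) = \<Phi> 1 x" using k l real by auto
  then have "\<sigma> (\<sigma> x) = x" using inj by simp
  then have "\<kappa> x = \<sigma> x" using funpow_involution[of \<sigma> x m] m odd by simp
  then show False using kx sx by simp
qed

end

theorem proposition3p3:
  fixes F I :: "'k::field_char_0 set" and \<xi> :: 'k
    and \<Phi> :: "2 \<Rightarrow> 'k \<Rightarrow> complex" and Z :: "complex^2^2"
  assumes "real_quadratic_field F"
    and "quartic_CM_field TYPE('k)"
    and "galois_over_rat TYPE('k)"
    and "CM_triple I \<xi> \<Phi>"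
    and "reduced_matrix_of I \<xi> \<Phi> Z"
    and "cyclic_auts TYPE('k) \<or> Z $ 1 $ 2 \<noteq> 0"
  shows "cmod (Z $ 1 $ 2) \<ge> 2 / 3 * \<bar>real_of_int (quartic_discriminant TYPE('k))\<bar> powr (-1/2)"
proof -
  define z1 where "z1 = Z $ 1 $ 1"
  define z12 where "z12 = Z $ 1 $ 2"
  define z2 where "z2 = Z $ 2 $ 2"
  obtain e' where Zdom: "Z \<in> siegel_fundamental_domain" and sb: "symplectic_basis I \<xi> \<Phi> e'"
    and per3: "CM_vec \<Phi> (e' 3) = z1 *s CM_vec \<Phi> (e' 1) + z12 *s CM_vec \<Phi> (e' 2)"
    and per4: "CM_vec \<Phi> (e' 4) = z12 *s CM_vec \<Phi> (e' 1) + z2 *s CM_vec \<Phi> (e' 2)"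
    using assms(5) unfolding reduced_matrix_of_def z1_def z12_def z2_def by blast
  define e where "e = e' \<circ> four_index"
  have ee: "e 1 = e' 1" "e 2 = e' 2" "e 3 = e' 3" "e 4 = e' 4" by (simp_all add: e_def)
  have CM: "CM_type \<Phi>" and Im_xi: "\<And>j. Im (\<Phi> j \<xi>) > 0" and ideal: "fractional_ideal I"
    and ti: "totally_imaginary \<xi>"
    using assms(4) by (auto simp: CM_triple_def)
  have Re_xi: "Re (\<Phi> j \<xi>) = 0" for j using ti CM by (simp add: totally_imaginary_def CM_type_def)
  have basis: "Z_basis UNIV e I"
    unfolding e_def using sb four_index_bij by (intro Z_basis_reindex[of "{1..4}"]) (auto simp: symplectic_basis_def)
  have mem: "four_index i \<in> {1..4}" for i using four_index_bij by (auto simp: bij_betw_def)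
  have rf: "riemann_form \<Phi> \<xi> (CM_vec \<Phi> (e i)) (CM_vec \<Phi> (e j)) =
      (if four_index j = four_index i + 2 then 1 else if four_index i = four_index j + 2 then -1 else 0)" for i j
    using sb mem[of i] mem[of j] unfolding symplectic_basis_def e_def by simp
  define t1 where "t1 = Im (\<Phi> 1 \<xi>)"
  define t2 where "t2 = Im (\<Phi> 2 \<xi>)"
  have t: "t1 > 0" "t2 > 0" using Im_xi by (simp_all add: t1_def t2_def)
  have detE: "cmod (det (emb_mat \<Phi> e)) * (t1 * t2) = 1"
    using det_symplectic[of \<Phi> \<xi> e, OF Re_xi rf] t by (simp add: t1_def t2_def)
  interpret CM_lattice \<Phi> \<xi> I e
  proof
    show "degree_over_rat (UNIV :: 'k set) = 4" using assms(2) by (simp add: quartic_CM_field_def)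
    show "det (emb_mat \<Phi> e) \<noteq> 0" using detE by auto
  qed (use CM Im_xi ideal basis in auto)
  obtain b :: "4 \<Rightarrow> 'k" where b: "Z_basis UNIV b ring_of_integers" using integral_basis_exists by blast
  obtain \<kappa> :: "'k \<Rightarrow> 'k" where \<kappa>: "\<And>\<phi> x. \<phi> \<in> embeddings \<Longrightarrow> \<phi> (\<kappa> x) = cnj (\<phi> x)"
    using CM_conj_exists assms(2) unfolding quartic_CM_field_def by blast
  have e3: "\<Phi> j (e 3) = z1 * \<Phi> j (e 1) + z12 * \<Phi> j (e 2)" for j
    using arg_cong[OF per3, of "\<lambda>v. v $ j"] by (simp add: ee CM_vec_def)
  have e4: "\<Phi> j (e 4) = z12 * \<Phi> j (e 1) + z2 * \<Phi> j (e 2)" for j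
    using arg_cong[OF per4, of "\<lambda>v. v $ j"] by (simp add: ee CM_vec_def)

  define dY where "dY = Im z1 * Im z2 - (Im z12)\<^sup>2"
  have z1: "Im z1 > 0" and dY: "dY \<ge> 9 / 16"
    using fundamental_domain_bounds[OF Zdom] by (simp_all add: z1_def z12_def z2_def dY_def)
  define d where "d = \<bar>real_of_int (quartic_discriminant TYPE('k))\<bar>"
  have d1: "d \<ge> 1" using discriminant_nz[OF b] unfolding d_def by linarith
  have d_eq: "d = (cmod (det (emb_mat \<Phi> b)))\<^sup>2"
    using arg_cong[OF discriminant_eq[OF b], of cmod] by (simp add: d_def norm_power)

  note form = riemann_form_eq[of \<Phi> \<xi>, OF Re_xi, folded t1_def t2_def]
  have form_real: "2 * (t1 * Im (cnj (\<Phi> 1 (e i)) * \<Phi> 1 (e j)) + t2 * Im (cnj (\<Phi> 2 (e i)) * \<Phi> 2 (e j))) =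
      (if four_index j = four_index i + 2 then 1 else if four_index i = four_index j + 2 then -1 else 0)" for i j
    using arg_cong[OF rf[of i j, unfolded form], of Re] by (simp only: Re_complex_of_real) (simp split: if_splits)
  define D where "D = (cmod (\<Phi> 1 (e 1) * \<Phi> 2 (e 2) - \<Phi> 2 (e 1) * \<Phi> 1 (e 2)))\<^sup>2"
  \<comment> \<open>Folding the period equations back into \<open>e 3\<close> and \<open>e 4\<close>
    turns the premises into instances of \<open>form_real\<close>.\<close>
  have D: "4 * (t1 * t2 * D) * dY = 1"
    unfolding D_def dY_def
    by (rule period_relations; (subst e3[symmetric])?; (subst e3[symmetric])?; (subst e4[symmetric])?; (subst e4[symmetric])?; subst form_real; simp)
  define s where "s = minorS (e 1) (e 3)"
  define u where "u = minorT (e 1) (e 3)"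
  \<comment> \<open>Cramer's rule: in the minor with \<open>e 1\<close> the term
    \<open>z1 * \<Phi> j (e 1)\<close> of \<open>e 3\<close> cancels.\<close>
  have s: "cmod s = (cmod z12)\<^sup>2 * D"
  proof -
    have "\<Phi> 1 (e 1) * \<Phi> 2 (e 3) - \<Phi> 2 (e 1) * \<Phi> 1 (e 3) = z12 * (\<Phi> 1 (e 1) * \<Phi> 2 (e 2) - \<Phi> 2 (e 1) * \<Phi> 1 (e 2))"
      unfolding e3 by (simp add: algebra_simps)
    then show ?thesis
      unfolding s_def minorS_def D_def norm_mult complex_mod_cnj by (simp add: norm_mult power2_eq_square mult_ac)
  qed
  have u: "cmod u \<le> cmod s + 1 / (4 * (t1 * t2))"
  proof -
    have "cmod u = (cmod (\<Phi> 1 (e 1) * cnj (\<Phi> 2 (e 3)) - cnj (\<Phi> 2 (e 1)) * \<Phi> 1 (e 3)))\<^sup>2"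
      "cmod s = (cmod (\<Phi> 1 (e 1) * \<Phi> 2 (e 3) - \<Phi> 2 (e 1) * \<Phi> 1 (e 3)))\<^sup>2"
      unfolding u_def minorT_def s_def minorS_def norm_mult complex_mod_cnj by (simp_all add: power2_eq_square)
    then show ?thesis using minors_comparison[OF t, of "\<Phi> 1 (e 1)" "\<Phi> 1 (e 3)" "\<Phi> 2 (e 1)" "\<Phi> 2 (e 3)"]
        form_real[of 1 3] by simp
  qed

  \<comment> \<open>If \<open>z12\<close> vanished, both embeddings of the CM type would send
    \<open>e 3 / e 1\<close> to the nonreal number \<open>z1\<close>, which cyclicity
    excludes.\<close>
  have "z12 \<noteq> 0"
  proof
    assume z12: "z12 = 0"
    then have "cyclic_auts TYPE('k)" using assms(6) by (simp add: z12_def)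
    moreover have "\<Phi> j (e 3 / e 1) = z1" for j
      using e3[of j] z12 e_nz[of 1] by (simp add: emb_divide[OF Phi_emb] emb_eq_0_iff[OF Phi_emb])
    ultimately show False
      using cyclic_no_imaginary_quadratic[of F \<kappa> "e 3 / e 1" z1, OF assms(1,3) _ \<kappa>] z1 by auto
  qed
  moreover have "D \<noteq> 0" using D by auto
  ultimately have s_nz: "s \<noteq> 0" using s by auto

  define \<rho> where "\<rho> = cmod (det (emb_mat \<Phi> e) / det (emb_mat \<Phi> b))"
  define \<tau> where "\<tau> = t1 * t2"
  have \<tau>: "\<tau> > 0" using t by (simp add: \<tau>_def)
  have \<rho>: "(\<rho> * \<tau>)\<^sup>2 = 1 / d"
  proof -
    have "\<rho> * \<tau> = 1 / cmod (det (emb_mat \<Phi> b))" using detE by (simp add: \<rho>_def norm_divide \<tau>_def)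
    then show ?thesis by (simp add: d_eq power_divide)
  qed
  \<comment> \<open>Multiplication by \<open>\<tau>\<close> normalises the bounds. If
    \<open>u = 0\<close>, even the square of \<open>cmod s * \<tau>\<close> is at least
    \<open>1 / d\<close>.\<close>
  have "1 / d \<le> cmod s * \<tau> * (cmod s * \<tau> + 1 / 4)"
  proof (cases "u = 0")
    case True
    then have "\<rho> \<le> cmod s"
      using minors_lower_bound(2)[of \<kappa> b 1 3, OF \<kappa> b] s_nz by (simp add: s_def u_def \<rho>_def)
    then have "(\<rho> * \<tau>)\<^sup>2 \<le> (cmod s * \<tau>)\<^sup>2" using \<tau> by (intro power_mono mult_right_mono) (auto simp: \<rho>_def)
    also have "\<dots> \<le> cmod s * \<tau> * (cmod s * \<tau> + 1 / 4)" using \<tau> by (simp add: power2_eq_square algebra_simps)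
    finally show ?thesis by (simp add: \<rho>)
  next
    case False
    then have "\<rho>\<^sup>2 \<le> cmod s * cmod u"
      using minors_lower_bound(1)[of \<kappa> b 1 3, OF \<kappa> b] s_nz by (simp add: s_def u_def \<rho>_def)
    also have "\<dots> \<le> cmod s * (cmod s + 1 / (4 * \<tau>))" using u by (intro mult_left_mono) (auto simp: \<tau>_def)
    finally have "\<rho>\<^sup>2 * \<tau>\<^sup>2 \<le> cmod s * (cmod s + 1 / (4 * \<tau>)) * \<tau>\<^sup>2" by (intro mult_right_mono) auto
    also have "\<dots> = cmod s * \<tau> * (cmod s * \<tau> + 1 / 4)" using \<tau> by (simp add: field_simps power2_eq_square)
    finally show ?thesis by (simp add: \<rho>[symmetric] power_mult_distrib)
  qed
  then have est: "cmod s * \<tau> \<ge> 16 / (81 * d)" using d1 \<tau> by (intro final_estimate) auto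
  have "(cmod z12)\<^sup>2 = 4 * (cmod s * \<tau>) * dY"
  proof -
    have "4 * (cmod s * \<tau>) * dY = (cmod z12)\<^sup>2 * (4 * (t1 * t2 * D) * dY)" by (simp add: s \<tau>_def mult_ac)
    then show ?thesis by (simp only: D)
  qed
  moreover have "4 * (16 / (81 * d)) * (9 / 16) \<le> 4 * (cmod s * \<tau>) * dY"
    using est dY d1 \<tau> by (intro mult_mono) auto
  moreover have "4 * (16 / (81 * d)) * (9 / 16) = (2 / 3 * (1 / sqrt d))\<^sup>2"
    using d1 by (simp add: power_mult_distrib power_divide)
  ultimately have "(2 / 3 * (1 / sqrt d))\<^sup>2 \<le> (cmod z12)\<^sup>2" by linarith
  then have "2 / 3 * (1 / sqrt d) \<le> cmod z12" by (rule power2_le_imp_le) simp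
  moreover have "d powr (-1/2) = 1 / sqrt d"
    using d1 by (simp add: powr_minus powr_half_sqrt inverse_eq_divide)
  ultimately show ?thesis by (simp add: d_def z12_def)
qed

end
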